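(* Let $N$ and $M$ be positive integers that are multiples of $4$ with $N>M$, and let $H_N$ and $H_M$ be the Hadamard graphs on $2^N$ and $2^M$ vertices respectively. Then $$\chi_q(H_N\times H_M) = M,$$ where $\times$ denotes the categorical product of graphs and $\chi_q$ the quantum chromatic number.
   Context: Hadamard graph: for $N$ a positive multiple of $4$, $H_N$ is the simple graph whose vertices are the $2^N$ vectors in $\{+1,-1\}^N$, two vertices being adjacent if and only if their inner product is $0$ (equivalently, they differ in exactly half of their entries). Categorical product: for graphs $G,H$, the graph $G\times H$ has vertex set $V(G)\times V(H)$, with $(v,w)\sim(x,y)$ if and only if $v\sim x$ in $G$ and $w\sim y$ in $H$. Quantum chromatic number: for a finite simple graph $G$ and a positive integer $c$, a winning quantum strategy with $c$ colors in the graph coloring game for $G$ consists of positive integers $a,b$, a unit vector $\psi\in\mathbb{C}^a\otimes\mathbb{C}^b$, and, for each vertex $x\in V(G)$, positive operator valued measures $\{E_{x,\alpha}\}_{\alpha=1}^c\subset M_a(\mathbb{C})$ and $\{F_{x,\alpha}\}_{\alpha=1}^c\subset M_b(\mathbb{C})$ (positive semidefinite matrices with $\sum_\alpha E_{x,\alpha}=I$ and $\sum_\alpha F_{x,\alpha}=I$), such that the probabilities $p(\alpha,\beta\mid x,y)=\langle\psi|E_{x,\alpha}\otimes F_{y,\beta}|\psi\rangle$ satisfy: (1) $p(\alpha,\beta\mid x,x)=0$ for every vertex $x$ and all $\alpha\neq\beta$; (2) $p(\alpha,\alpha\mid x,y)=0$ for all adjacent vertices $x\sim y$ and every color $\alpha$.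 The quantum chromatic number $\chi_q(G)$ is the smallest $c$ for which a winning quantum strategy with $c$ colors exists. *)

theory Defs
  imports "Jordan_Normal_Form.Conjugate" "Jordan_Normal_Form.Matrix" "Graph_Theory.Pair_Digraph"
begin

text \<open>
  Finite simple graphs are represented by the locale \<^locale>\<open>pair_graph\<close>: finite, loop-free digraphs
  with a symmetric arc relation, an edge being a pair of opposite arcs.
\<close>

subsection \<open>Hadamard graphs and the categorical product\<close>

definition sign_vectors :: "nat \<Rightarrow> int vec set" where
  "sign_vectors N = {v \<in> carrier_vec N. \<forall>i<N. v $ i \<in> {1, -1}}"

text \<open>
  The definition is total in \<open>N\<close>; for \<open>N = 0\<close> it has a loop, so it is a simple graph only for
  \<open>N > 0\<close>.
\<close>

definition hadamard_graph :: "nat \<Rightarrow> int vec pair_pre_digraph" where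
  "hadamard_graph N =
     \<lparr> pverts = sign_vectors N,
       parcs = {(v, w). v \<in> sign_vectors N \<and> w \<in> sign_vectors N \<and> v \<bullet> w = 0} \<rparr>"

definition categorical_product ::
  "'a pair_pre_digraph \<Rightarrow> 'b pair_pre_digraph \<Rightarrow> ('a \<times> 'b) pair_pre_digraph" where
  "categorical_product G H =
     \<lparr> pverts = pverts G \<times> pverts H,
       parcs = {((v, w), (x, y)) | v w x y. (v, x) \<in> parcs G \<and> (w, y) \<in> parcs H} \<rparr>"

subsection \<open>Quantum strategies\<close>

text \<open>
  In the order on \<^typ>\<open>complex\<close>, \<open>0 \<le> z\<close> says that \<open>z\<close> is real and nonnegative, so the quadratic
  form condition already forces \<open>A\<close> to be Hermitian. The product \<open>v \<bullet>c w\<close> is conjugate-linear in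
  \<open>w\<close>.
\<close>

definition positive_semidefinite :: "nat \<Rightarrow> complex mat \<Rightarrow> bool" where
  "positive_semidefinite n A \<longleftrightarrow>
     A \<in> carrier_mat n n \<and> (\<forall>v \<in> carrier_vec n. 0 \<le> (A *\<^sub>v v) \<bullet>c v)"

text \<open>
  The matrix sum is written out entrywise, as \<^typ>\<open>complex mat\<close> has no zero of unspecified
  dimension and hence no \<^const>\<open>sum\<close>.
\<close>

definition povm :: "nat \<Rightarrow> nat \<Rightarrow> (nat \<Rightarrow> complex mat) \<Rightarrow> bool" where
  "povm n c E \<longleftrightarrow>
     (\<forall>\<alpha> \<in> {1..c}. positive_semidefinite n (E \<alpha>)) \<and>
     mat n n (\<lambda>(i, j). \<Sum>\<alpha> \<in> {1..c}. E \<alpha> $$ (i, j)) = 1\<^sub>m n"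

text \<open>
  \<open>\<complex>\<^sup>a \<otimes> \<complex>\<^sup>b\<close> is identified with \<open>\<complex>\<^sup>a\<^sup>b\<close> by sending \<open>e\<^sub>i \<otimes> e\<^sub>j\<close> to
  \<open>e\<^sub>k\<close> with \<open>k = i * b + j\<close>; under this identification \<open>A \<otimes> B\<close> is the Kronecker product.
\<close>

definition kronecker_product :: "complex mat \<Rightarrow> complex mat \<Rightarrow> complex mat" where
  "kronecker_product A B =
     mat (dim_row A * dim_row B) (dim_col A * dim_col B)
       (\<lambda>(i, j). A $$ (i div dim_row B, j div dim_col B) * B $$ (i mod dim_row B, j mod dim_col B))"

definition outcome_probability :: "complex vec \<Rightarrow> complex mat \<Rightarrow> complex mat \<Rightarrow> complex" where
  "outcome_probability \<psi> A B = (kronecker_product A B *\<^sub>v \<psi>) \<bullet>c \<psi>"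

definition winning_quantum_strategy ::
  "'v pair_pre_digraph \<Rightarrow> nat \<Rightarrow> nat \<Rightarrow> nat \<Rightarrow> complex vec \<Rightarrow>
     ('v \<Rightarrow> nat \<Rightarrow> complex mat) \<Rightarrow> ('v \<Rightarrow> nat \<Rightarrow> complex mat) \<Rightarrow> bool" where
  "winning_quantum_strategy G c a b \<psi> E F \<longleftrightarrow>
     0 < a \<and> 0 < b \<and>
     \<psi> \<in> carrier_vec (a * b) \<and> \<psi> \<bullet>c \<psi> = 1 \<and>
     (\<forall>x \<in> pverts G. povm a c (E x) \<and> povm b c (F x)) \<and>
     (\<forall>x \<in> pverts G. \<forall>\<alpha> \<in> {1..c}. \<forall>\<beta> \<in> {1..c}.
        \<alpha> \<noteq> \<beta> \<longrightarrow> outcome_probability \<psi> (E x \<alpha>) (F x \<beta>) = 0) \<and>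
     (\<forall>x y. (x, y) \<in> parcs G \<longrightarrow>
        (\<forall>\<alpha> \<in> {1..c}. outcome_probability \<psi> (E x \<alpha>) (F y \<alpha>) = 0))"

definition quantum_colorable :: "'v pair_pre_digraph \<Rightarrow> nat \<Rightarrow> bool" where
  "quantum_colorable G c \<longleftrightarrow> 0 < c \<and> (\<exists>a b \<psi> E F. winning_quantum_strategy G c a b \<psi> E F)"

definition quantum_chromatic_number :: "'v pair_pre_digraph \<Rightarrow> nat" where
  "quantum_chromatic_number G = (LEAST c. quantum_colorable G c)"

subsection \<open>Well-definedness\<close>

lemma finite_sign_vectors: "finite (sign_vectors N)"
proof -
  have "sign_vectors N \<subseteq> vec_of_list ` {xs. set xs \<subseteq> {1, -1} \<and> length xs = N}"
  proof
    fix v assume v: "v \<in> sign_vectors N"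
    have "v = vec_of_list (list_of_vec v)" by (simp add: vec_list)
    moreover have "set (list_of_vec v) \<subseteq> {1, -1}" "length (list_of_vec v) = N"
      using v by (auto simp: sign_vectors_def set_list_of_vec vec_set_def)
    ultimately show "v \<in> vec_of_list ` {xs. set xs \<subseteq> {1, -1} \<and> length xs = N}" by blast
  qed
  then show ?thesis by (rule finite_subset) (simp add: finite_lists_length_eq)
qed

lemma sign_vector_self_product:
  assumes "v \<in> sign_vectors N" shows "v \<bullet> v = int N"
proof -
  have "v $ i * v $ i = 1" if "i < N" for i
    using assms that by (auto simp: sign_vectors_def)
  moreover have "dim_vec v = N" using assms by (auto simp: sign_vectors_def)
  ultimately show ?thesis by (simp add: scalar_prod_def)
qed

lemma pair_graph_hadamard_graph:
  assumes "0 < N" shows "pair_graph (hadamard_graph N)"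
proof
  let ?V = "sign_vectors N"
  show "finite (pverts (hadamard_graph N))"
    by (simp add: hadamard_graph_def finite_sign_vectors)
  have "parcs (hadamard_graph N) \<subseteq> ?V \<times> ?V" by (auto simp: hadamard_graph_def)
  then show "finite (parcs (hadamard_graph N))"
    by (rule finite_subset) (simp add: finite_sign_vectors)
  show "symmetric (with_proj (hadamard_graph N))"
    by (auto simp: symmetric_def sym_def hadamard_graph_def sign_vectors_def
        intro: comm_scalar_prod[THEN trans])
qed (use assms in \<open>auto simp: hadamard_graph_def dest: sign_vector_self_product\<close>)

lemma pair_graph_categorical_product:
  assumes "pair_graph G" "pair_graph H" shows "pair_graph (categorical_product G H)"
proof -
  interpret G: pair_graph G by fact
  interpret H: pair_graph H by fact
  show ?thesis
  proof
    show "finite (pverts (categorical_product G H))"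
      by (simp add: categorical_product_def)
    have "parcs (categorical_product G H)
        \<subseteq> (pverts G \<times> pverts H) \<times> (pverts G \<times> pverts H)"
      by (auto simp: categorical_product_def G.in_arcsD1 G.in_arcsD2 H.in_arcsD1 H.in_arcsD2)
    then show "finite (parcs (categorical_product G H))"
      by (rule finite_subset) simp
    show "symmetric (with_proj (categorical_product G H))"
      by (auto simp: symmetric_def sym_def categorical_product_def
          G.arcs_symmetric H.arcs_symmetric)
  qed (auto simp: categorical_product_def G.in_arcsD1 G.in_arcsD2 H.in_arcsD1 H.in_arcsD2
        dest: G.no_loops' H.no_loops')
qed

text \<open>
  Every finite simple graph has a winning strategy, so the minimum in
  \<^const>\<open>quantum_chromatic_number\<close> is attained.
\<close>

lemma povm_deterministic:
  assumes "k \<in> {1..c}"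
  shows "povm 1 c (\<lambda>\<alpha>. if \<alpha> = k then 1\<^sub>m 1 else 0\<^sub>m 1 1)"
proof -
  have "0 \<le> v $ 0 * cnj (v $ 0)" for v :: "complex vec"
    using conjugate_square_positive[of "v $ 0"] by simp
  then have "positive_semidefinite 1 (if \<alpha> = k then 1\<^sub>m 1 else 0\<^sub>m 1 1)" for \<alpha>
    by (auto simp: positive_semidefinite_def scalar_prod_def)
  moreover have "(\<Sum>\<alpha> \<in> {1..c}. (if \<alpha> = k then 1\<^sub>m 1 else 0\<^sub>m 1 1 :: complex mat) $$ (0, 0)) = 1"
  proof -
    have "(\<Sum>\<alpha> \<in> {1..c}. (if \<alpha> = k then 1\<^sub>m 1 else 0\<^sub>m 1 1 :: complex mat) $$ (0, 0))
        = (\<Sum>\<alpha> \<in> {1..c}. if \<alpha> = k then 1 else 0)"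
      by (rule sum.cong) auto
    then show ?thesis using assms by simp
  qed
  ultimately show ?thesis by (auto simp: povm_def intro!: eq_matI)
qed

lemma quantum_colorable_finite:
  assumes "pair_graph G" shows "\<exists>c. quantum_colorable G c"
proof -
  interpret pair_graph G by fact
  obtain f :: "'a \<Rightarrow> nat" where f: "inj_on f (pverts G)" "f ` pverts G = {i. i < card (pverts G)}"
    using ex_bij_betw_finite_nat[OF pair_finite_verts]
    by (auto simp: bij_betw_def atLeast0LessThan lessThan_def)
  define c where "c = Suc (card (pverts G))"
  define E :: "'a \<Rightarrow> nat \<Rightarrow> complex mat"
    where "E x \<alpha> = (if \<alpha> = Suc (f x) then 1\<^sub>m 1 else 0\<^sub>m 1 1)" for x \<alpha>
  define \<psi> :: "complex vec" where "\<psi> = vec 1 (\<lambda>_. 1)"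
  have P: "outcome_probability \<psi> (E x \<alpha>) (E y \<beta>) = 0"
    if "\<alpha> \<noteq> Suc (f x) \<or> \<beta> \<noteq> Suc (f y)" for x y \<alpha> \<beta>
    using that by (auto simp: outcome_probability_def kronecker_product_def E_def \<psi>_def
        scalar_prod_def)
  have "winning_quantum_strategy G c 1 1 \<psi> E E"
    unfolding winning_quantum_strategy_def
  proof (intro conjI ballI allI impI)
    fix x assume x: "x \<in> pverts G"
    then have "f x < card (pverts G)" using f(2) by blast
    then have "Suc (f x) \<in> {1..c}" by (simp add: c_def)
    from povm_deterministic[OF this] show "povm 1 c (E x)" "povm 1 c (E x)"
      by (simp_all add: E_def[abs_def])
  next
    fix x y \<alpha> assume "(x, y) \<in> parcs G"
    then have "f x \<noteq> f y"
      using f(1) by (metis in_arcsD1 in_arcsD2 inj_on_eq_iff no_loops')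
    then show "outcome_probability \<psi> (E x \<alpha>) (E y \<alpha>) = 0"
      using P by (metis nat.inject)
  next
    fix x \<alpha> \<beta> assume "\<alpha> \<noteq> (\<beta>::nat)"
    then show "outcome_probability \<psi> (E x \<alpha>) (E x \<beta>) = 0" using P by metis
  qed (auto simp: \<psi>_def scalar_prod_def)
  moreover have "0 < c" by (simp add: c_def)
  ultimately have "quantum_colorable G c" unfolding quantum_colorable_def by blast
  then show ?thesis by blast
qed

end

theory Submission
  imports Defs 
begin

text \<open>
  Upper bound. The projection \<open>H\<^sub>N \<times> H\<^sub>M \<rightarrow> H\<^sub>M\<close> is a graph homomorphism, and strategies pull back
  along homomorphisms (\<open>quantum_colorable_homomorphism\<close>), so it is enough to colour \<open>H\<^sub>M\<close> with \<open>M\<close>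
  colours. Attach to a vertex \<open>x\<close> the Fourier basis of \<open>\<complex>\<^sup>M\<close> with its coordinates multiplied by the
  signs \<open>x\<^sub>i\<close>. For two vertices \<open>x\<close> and \<open>y\<close> the basis vectors with the same index have inner product
  \<open>x \<bullet> y / M\<close>, which vanishes on edges. If both players share a maximally entangled state and measure
  in these bases (one of them in the conjugate basis), the probability of a pair of outcomes is a
  multiple of the squared modulus of such an inner product (\<open>quantum_colorable_bases\<close>).

  Lower bound. In a winning strategy the vectors \<open>(E\<^sub>x\<^sub>\<alpha> \<otimes> I)\<psi>\<close> and \<open>(I \<otimes> F\<^sub>x\<^sub>\<alpha>)\<psi>\<close> coincide: their
  inner product is \<open>p(\<alpha>,\<alpha>|x,x)\<close>, which also bounds both of their squared norms because \<open>E\<^sup>2 \<le> E\<close> for an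
  effect \<open>E\<close>. Hence all outcome probabilities are inner products within one family \<open>u\<^sub>x\<^sub>\<alpha>\<close>; for a fixed
  vertex these vectors are orthogonal with sum \<open>\<psi>\<close>, and \<open>u\<^sub>x\<^sub>\<alpha> \<bottom> u\<^sub>y\<^sub>\<alpha>\<close> on edges
  (\<open>winning_strategy_vectors\<close>). The classical argument of Hoffman for colour classes, applied to the
  coordinates of this family instead of indicator functions, shows that the number of colours of a
  \<open>d\<close>-regular graph with least eigenvalue \<open>-k\<close> is at least \<open>1 + d/k\<close> (\<open>quantum_hoffman_bound\<close>).

  It remains to find the spectrum. Both Hadamard graphs are Cayley graphs of elementary abelian
  2-groups, so the characters \<open>\<Prod>\<^sub>i\<^sub>\<in>\<^sub>S x\<^sub>i\<close> diagonalise them. The eigenvalue of \<open>S\<close> is the sum of the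
  character over all balanced sign vectors. Multiplying the character by \<open>\<Sum>\<^sub>i z\<^sub>i = 0\<close> gives a
  two-step recursion in \<open>|S|\<close>, from which every eigenvalue of \<open>H\<^sub>N\<close> is at least \<open>-d\<^sub>N / (N - 1)\<close>, where
  \<open>d\<^sub>N\<close> is the degree (\<open>hadamard_eigenvalue_ge\<close>). The eigenvalues of the product are the products of
  eigenvalues; since \<open>M < N\<close>, the least one is at least \<open>-d\<^sub>N d\<^sub>M / (M - 1)\<close>, and the Hoffman bound
  becomes \<open>1 + (M - 1) = M\<close>.
\<close>

section \<open>Quadratic forms of positive semidefinite matrices\<close>

text \<open>
  Vectors are functions on \<open>nat\<close> restricted to an initial segment, which keeps the forms below
  sesquilinear without side conditions on dimensions.
\<close>

definition inner_prod :: "nat \<Rightarrow> (nat \<Rightarrow> complex) \<Rightarrow> (nat \<Rightarrow> complex) \<Rightarrow> complex" where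
  "inner_prod n f g = (\<Sum>i<n. f i * cnj (g i))"

definition mat_app :: "nat \<Rightarrow> complex mat \<Rightarrow> (nat \<Rightarrow> complex) \<Rightarrow> nat \<Rightarrow> complex" where
  "mat_app n A f i = (\<Sum>j<n. A $$ (i, j) * f j)"

lemma inner_prod_add_left: "inner_prod n (\<lambda>i. f i + g i) h = inner_prod n f h + inner_prod n g h"
  by (simp add: inner_prod_def sum.distrib algebra_simps)

lemma inner_prod_add_right: "inner_prod n h (\<lambda>i. f i + g i) = inner_prod n h f + inner_prod n h g"
  by (simp add: inner_prod_def sum.distrib algebra_simps)

lemma inner_prod_scale_left: "inner_prod n (\<lambda>i. c * f i) h = c * inner_prod n f h"
  by (simp add: inner_prod_def sum_distrib_left algebra_simps)

lemma inner_prod_scale_right: "inner_prod n h (\<lambda>i. c * f i) = cnj c * inner_prod n h f"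
  by (simp add: inner_prod_def sum_distrib_left algebra_simps)

lemma inner_prod_self: "inner_prod n f f = of_real (\<Sum>i<n. (cmod (f i))\<^sup>2)"
  by (simp add: inner_prod_def complex_norm_square del: of_real_power)

lemma inner_prod_cnj: "cnj (inner_prod n f g) = inner_prod n g f"
  by (simp add: inner_prod_def mult.commute)

lemma mat_app_add: "mat_app n A (\<lambda>i. f i + g i) = (\<lambda>i. mat_app n A f i + mat_app n A g i)"
  by (simp add: mat_app_def sum.distrib algebra_simps fun_eq_iff)

lemma mat_app_scale: "mat_app n A (\<lambda>i. c * f i) = (\<lambda>i. c * mat_app n A f i)"
  by (simp add: mat_app_def sum_distrib_left algebra_simps fun_eq_iff)

lemma mat_app_unit: "j < n \<Longrightarrow> mat_app n A (\<lambda>k. if k = j then 1 else 0) i = A $$ (i, j)"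
proof -
  assume "j < n"
  have "mat_app n A (\<lambda>k. if k = j then 1 else 0) i = (\<Sum>k<n. if k = j then A $$ (i, k) else 0)"
    unfolding mat_app_def by (rule sum.cong) auto
  then show ?thesis using \<open>j < n\<close> by simp
qed

lemma inner_prod_unit: "i < n \<Longrightarrow> inner_prod n f (\<lambda>k. if k = i then 1 else 0) = f i"
proof -
  assume "i < n"
  have "inner_prod n f (\<lambda>k. if k = i then 1 else 0) = (\<Sum>k<n. if k = i then f k else 0)"
    unfolding inner_prod_def by (rule sum.cong) auto
  then show ?thesis using \<open>i < n\<close> by simp
qed

lemma positive_semidefinite_form:
  assumes "positive_semidefinite n A"
  shows "0 \<le> inner_prod n (mat_app n A f) f"
proof -
  have A: "A \<in> carrier_mat n n" using assms by (simp add: positive_semidefinite_def)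
  have "0 \<le> (A *\<^sub>v vec n f) \<bullet>c vec n f"
    using assms by (simp add: positive_semidefinite_def)
  also have "(A *\<^sub>v vec n f) \<bullet>c vec n f = inner_prod n (mat_app n A f) f"
    using A unfolding inner_prod_def mat_app_def scalar_prod_def
    by (auto intro!: sum.cong simp: atLeast0LessThan scalar_prod_def)
  finally show ?thesis .
qed

text \<open>
  Polarisation: the form is real on \<open>f + g\<close> and on \<open>f + \<i> g\<close>, which determines the imaginary and the
  real part of the mixed terms.
\<close>

lemma positive_semidefinite_self_adjoint:
  assumes A: "positive_semidefinite n A"
  shows "inner_prod n (mat_app n A f) g = cnj (inner_prod n (mat_app n A g) f)"
proof -
  let ?s = "\<lambda>f g. inner_prod n (mat_app n A f) g"
  have re: "Im (?s h h) = 0" for h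
    using positive_semidefinite_form[OF A, of h] by (simp add: less_eq_complex_def)
  have 1: "?s (\<lambda>i. f i + g i) (\<lambda>i. f i + g i) = ?s f f + ?s f g + (?s g f + ?s g g)"
    by (simp add: mat_app_add inner_prod_add_left inner_prod_add_right)
  have 2: "?s (\<lambda>i. f i + \<i> * g i) (\<lambda>i. f i + \<i> * g i)
      = ?s f f - \<i> * ?s f g + (\<i> * ?s g f + ?s g g)"
    by (simp add: mat_app_add mat_app_scale inner_prod_add_left inner_prod_add_right
        inner_prod_scale_left inner_prod_scale_right)
  have "Im (?s f g) = - Im (?s g f)"
    using arg_cong[OF 1, of Im] re by simp
  moreover have "Re (?s f g) = Re (?s g f)"
    using arg_cong[OF 2, of Im] re by simp
  ultimately show ?thesis by (simp add: complex_eq_iff)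
qed

lemma positive_semidefinite_hermitian:
  assumes "positive_semidefinite n A" "i < n" "j < n"
  shows "cnj (A $$ (i, j)) = A $$ (j, i)"
  using positive_semidefinite_self_adjoint[OF assms(1),
      of "\<lambda>k. if k = i then 1 else 0" "\<lambda>k. if k = j then 1 else 0"] assms(2,3)
  by (simp add: inner_prod_unit mat_app_unit)

lemma povm_sum_mat_app:
  assumes "povm n c E" "i < n"
  shows "(\<Sum>\<alpha>\<in>{1..c}. mat_app n (E \<alpha>) f i) = f i"
proof -
  have id: "(\<Sum>\<alpha>\<in>{1..c}. E \<alpha> $$ (i, j)) = (if i = j then 1 else 0)" if "j < n" for j
  proof -
    have "mat n n (\<lambda>(i, j). \<Sum>\<alpha> \<in> {1..c}. E \<alpha> $$ (i, j)) $$ (i, j) = 1\<^sub>m n $$ (i, j)"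
      using assms(1) by (simp add: povm_def)
    then show ?thesis using assms(2) that by simp
  qed
  have "(\<Sum>\<alpha>\<in>{1..c}. mat_app n (E \<alpha>) f i) = (\<Sum>j<n. (\<Sum>\<alpha>\<in>{1..c}. E \<alpha> $$ (i, j)) * f j)"
    unfolding mat_app_def by (subst sum.swap) (simp add: sum_distrib_right)
  also have "\<dots> = (\<Sum>j<n. if i = j then f j else 0)"
    by (rule sum.cong) (simp_all add: id del: One_nat_def)
  also have "\<dots> = f i" using assms(2) by simp
  finally show ?thesis .
qed

text \<open>
  An effect satisfies \<open>E\<^sup>2 \<le> E\<close>, because \<open>E - E\<^sup>2 = E (I - E) E + (I - E) E (I - E)\<close> is a sum of two
  positive semidefinite matrices.
\<close>

lemma povm_effect_square_le:
  assumes E: "povm n c E" and \<alpha>: "\<alpha> \<in> {1..c}"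
  shows "(\<Sum>i<n. (cmod (mat_app n (E \<alpha>) f i))\<^sup>2) \<le> Re (inner_prod n (mat_app n (E \<alpha>) f) f)"
proof -
  let ?s = "\<lambda>\<alpha> f g. inner_prod n (mat_app n (E \<alpha>) f) g"
  have psd: "positive_semidefinite n (E \<beta>)" if "\<beta> \<in> {1..c}" for \<beta>
    using E that by (simp add: povm_def)
  \<comment> \<open>\<open>E\<^sub>\<alpha> \<le> I\<close>, as the other effects only add to the form.\<close>
  have le_id: "Re (?s \<alpha> h h) \<le> Re (inner_prod n h h)" for h
  proof -
    have "inner_prod n h h = (\<Sum>i<n. (\<Sum>\<beta>\<in>{1..c}. mat_app n (E \<beta>) h i) * cnj (h i))"
      unfolding inner_prod_def by (intro sum.cong refl) (simp add: povm_sum_mat_app[OF E] del: One_nat_def)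
    also have "\<dots> = (\<Sum>\<beta>\<in>{1..c}. ?s \<beta> h h)"
      by (simp add: inner_prod_def sum_distrib_right) (rule sum.swap)
    finally have "Re (inner_prod n h h) = (\<Sum>\<beta>\<in>{1..c}. Re (?s \<beta> h h))" by simp
    moreover have "0 \<le> Re (?s \<beta> h h)" if "\<beta> \<in> {1..c}" for \<beta>
      using positive_semidefinite_form[OF psd[OF that], of h] by (simp add: less_eq_complex_def)
    ultimately show ?thesis
      using member_le_sum[of \<alpha> "{1..c}" "\<lambda>\<beta>. Re (?s \<beta> h h)"] \<alpha> by simp
  qed
  define h where "h = mat_app n (E \<alpha>) f"
  \<comment> \<open>\<open>?d = (I - E) f\<close>, written as a sum so that the additivity lemmas apply.\<close>
  let ?d = "\<lambda>i. f i + (-1) * h i"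
  have "?s \<alpha> ?d ?d = ?s \<alpha> f f - ?s \<alpha> f h - ?s \<alpha> h f + ?s \<alpha> h h"
    unfolding mat_app_add mat_app_scale inner_prod_add_left inner_prod_add_right
      inner_prod_scale_left inner_prod_scale_right by simp
  moreover have "?s \<alpha> h f = cnj (inner_prod n h h)"
    using positive_semidefinite_self_adjoint[OF psd[OF \<alpha>], of h f] by (simp add: h_def)
  ultimately have "?s \<alpha> ?d ?d = ?s \<alpha> f f - 2 * inner_prod n h h + ?s \<alpha> h h"
    by (simp add: h_def inner_prod_cnj)
  moreover have "0 \<le> Re (?s \<alpha> ?d ?d)"
    using positive_semidefinite_form[OF psd[OF \<alpha>], of ?d] by (simp add: less_eq_complex_def)
  ultimately have "Re (inner_prod n h h) \<le> Re (?s \<alpha> f f)"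
    using le_id[of h] by simp
  then show ?thesis by (simp add: inner_prod_self h_def)
qed

section \<open>Vectors obtained from a winning strategy\<close>

lemma sum_lessThan_mult_nat:
  fixes g :: "nat \<Rightarrow> 'a::comm_monoid_add"
  shows "(\<Sum>k<a * b. g k) = (\<Sum>i<a. \<Sum>j<b. g (i * b + j))"
proof -
  have "(\<Sum>k<a * b. g k) = (\<Sum>i<a. sum g {i * b..<i * b + b})"
    by (rule sum.nat_group[symmetric])
  also have "\<dots> = (\<Sum>i<a. \<Sum>j<b. g (i * b + j))"
  proof (rule sum.cong[OF refl])
    fix i
    show "sum g {i * b..<i * b + b} = (\<Sum>j<b. g (i * b + j))"
      by (rule sum.reindex_bij_witness[of _ "\<lambda>j. i * b + j" "\<lambda>k. k - i * b"]) auto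
  qed
  finally show ?thesis .
qed

lemma pair_index_less:
  fixes i j a b :: nat
  assumes "i < a" "j < b" shows "i * b + j < a * b"
proof -
  have "i * b + j < Suc i * b" using assms(2) by simp
  also have "\<dots> \<le> a * b" using assms(1) by (intro mult_le_mono1) simp
  finally show ?thesis .
qed

lemma outcome_probability_sum:
  assumes A: "A \<in> carrier_mat a a" and B: "B \<in> carrier_mat b b" and \<psi>: "\<psi> \<in> carrier_vec (a * b)"
  shows "outcome_probability \<psi> A B = (\<Sum>i<a. \<Sum>j<b. (\<Sum>i'<a. \<Sum>j'<b.
      A $$ (i, i') * B $$ (j, j') * \<psi> $ (i' * b + j')) * cnj (\<psi> $ (i * b + j)))"
proof -
  let ?K = "kronecker_product A B"
  have dims: "dim_row ?K = a * b" "dim_col ?K = a * b" "dim_vec \<psi> = a * b"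
    using A B \<psi> by (auto simp: kronecker_product_def)
  have "outcome_probability \<psi> A B
      = (\<Sum>k<a * b. (\<Sum>l<a * b. ?K $$ (k, l) * \<psi> $ l) * cnj (\<psi> $ k))"
    using dims by (auto simp: outcome_probability_def scalar_prod_def atLeast0LessThan
        intro!: sum.cong)
  also have "\<dots> = (\<Sum>i<a. \<Sum>j<b. (\<Sum>i'<a. \<Sum>j'<b. ?K $$ (i * b + j, i' * b + j')
      * \<psi> $ (i' * b + j')) * cnj (\<psi> $ (i * b + j)))"
    by (simp only: sum_lessThan_mult_nat)
  also have "\<dots> = (\<Sum>i<a. \<Sum>j<b. (\<Sum>i'<a. \<Sum>j'<b.
      A $$ (i, i') * B $$ (j, j') * \<psi> $ (i' * b + j')) * cnj (\<psi> $ (i * b + j)))"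
    using A B by (intro sum.cong refl arg_cong2[of _ _ _ _ "(*)"])
      (auto simp: kronecker_product_def pair_index_less)
  finally show ?thesis .
qed

text \<open>
  A vector of \<open>\<complex>\<^sup>a \<otimes> \<complex>\<^sup>b\<close> is treated as an \<open>a\<close> by \<open>b\<close> array: the first player acts on its columns and
  the second on its rows, so facts about a single system carry over by summing over columns or rows.
\<close>

definition tensor_inner ::
  "nat \<Rightarrow> nat \<Rightarrow> (nat \<Rightarrow> nat \<Rightarrow> complex) \<Rightarrow> (nat \<Rightarrow> nat \<Rightarrow> complex) \<Rightarrow> complex" where
  "tensor_inner a b X Y = (\<Sum>i<a. \<Sum>j<b. X i j * cnj (Y i j))"

lemma tensor_inner_rows: "tensor_inner a b X Y = (\<Sum>i<a. inner_prod b (X i) (Y i))"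
  by (simp add: tensor_inner_def inner_prod_def)

lemma tensor_inner_columns:
  "tensor_inner a b X Y = (\<Sum>j<b. inner_prod a (\<lambda>i. X i j) (\<lambda>i. Y i j))"
  unfolding tensor_inner_def inner_prod_def by (rule sum.swap)

lemma tensor_inner_cnj: "cnj (tensor_inner a b X Y) = tensor_inner a b Y X"
  by (simp add: tensor_inner_def mult.commute)

text \<open>
  \<open>A \<otimes> B = (A \<otimes> I) (I \<otimes> B)\<close> and \<open>A \<otimes> I\<close> is Hermitian, so it can be moved to the other argument of the
  inner product.
\<close>

lemma outcome_probability_inner:
  assumes A: "positive_semidefinite a A" and B: "positive_semidefinite b B"
    and \<psi>: "\<psi> \<in> carrier_vec (a * b)"
  shows "outcome_probability \<psi> A B = tensor_inner a b
    (\<lambda>i. mat_app b B (\<lambda>j. \<psi> $ (i * b + j))) (\<lambda>i j. mat_app a A (\<lambda>i. \<psi> $ (i * b + j)) i)"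
proof -
  define t where "t i i' j j' =
    A $$ (i, i') * B $$ (j, j') * \<psi> $ (i' * b + j') * cnj (\<psi> $ (i * b + j))" for i i' j j'
  have "outcome_probability \<psi> A B = (\<Sum>i<a. \<Sum>j<b. \<Sum>i'<a. \<Sum>j'<b. t i i' j j')"
    using A B \<psi> by (subst outcome_probability_sum[where a = a and b = b])
      (auto simp: positive_semidefinite_def t_def sum_distrib_right)
  also have "\<dots> = (\<Sum>j<b. \<Sum>i<a. \<Sum>i'<a. \<Sum>j'<b. t i i' j j')"
    by (rule sum.swap)
  also have "\<dots> = (\<Sum>j<b. \<Sum>i'<a. \<Sum>i<a. \<Sum>j'<b. t i i' j j')"
    by (rule sum.cong[OF refl]) (rule sum.swap)
  also have "\<dots> = (\<Sum>i'<a. \<Sum>j<b. \<Sum>i<a. \<Sum>j'<b. t i i' j j')"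
    by (rule sum.swap)
  also have "\<dots> = (\<Sum>i'<a. \<Sum>j<b. (\<Sum>j'<b. B $$ (j, j') * \<psi> $ (i' * b + j'))
      * cnj (\<Sum>i<a. A $$ (i', i) * \<psi> $ (i * b + j)))"
  proof (intro sum.cong refl)
    fix i' j assume i': "i' \<in> {..<a}" and j: "j \<in> {..<b}"
    have "(\<Sum>j'<b. B $$ (j, j') * \<psi> $ (i' * b + j')) * cnj (\<Sum>i<a. A $$ (i', i) * \<psi> $ (i * b + j))
        = (\<Sum>j'<b. B $$ (j, j') * \<psi> $ (i' * b + j')) * (\<Sum>i<a. A $$ (i, i') * cnj (\<psi> $ (i * b + j)))"
      using i' by (simp add: positive_semidefinite_hermitian[OF A])
    also have "\<dots> = (\<Sum>i<a. \<Sum>j'<b. t i i' j j')"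
      unfolding t_def sum_product by (subst sum.swap) (simp add: mult_ac)
    finally show "(\<Sum>i<a. \<Sum>j'<b. t i i' j j') = (\<Sum>j'<b. B $$ (j, j') * \<psi> $ (i' * b + j'))
        * cnj (\<Sum>i<a. A $$ (i', i) * \<psi> $ (i * b + j))" by simp
  qed
  finally show ?thesis by (simp add: tensor_inner_def mat_app_def)
qed

text \<open>
  The probabilities are inner products between a family \<open>u\<close> of the first player and a family \<open>v\<close> of
  the second. The winning conditions on equal questions force \<open>u = v\<close>, and the conditions on edges
  then become orthogonality relations within a single family.
\<close>

lemma winning_strategy_vectors:
  assumes W: "winning_quantum_strategy G c a b \<psi> E F"
  defines "\<Psi> \<equiv> \<lambda>i j. \<psi> $ (i * b + j)"
  defines "u \<equiv> \<lambda>x \<alpha> i j. mat_app a (E x \<alpha>) (\<lambda>i. \<psi> $ (i * b + j)) i"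
  shows "tensor_inner a b \<Psi> \<Psi> = 1"
    and "\<And>x i j. x \<in> pverts G \<Longrightarrow> i < a \<Longrightarrow> j < b \<Longrightarrow> (\<Sum>\<alpha>\<in>{1..c}. u x \<alpha> i j) = \<Psi> i j"
    and "\<And>x \<alpha> \<beta>. x \<in> pverts G \<Longrightarrow> \<alpha> \<in> {1..c} \<Longrightarrow> \<beta> \<in> {1..c} \<Longrightarrow> \<alpha> \<noteq> \<beta> \<Longrightarrow>
      tensor_inner a b (u x \<alpha>) (u x \<beta>) = 0"
    and "\<And>x y \<alpha>. (x, y) \<in> parcs G \<Longrightarrow> x \<in> pverts G \<Longrightarrow> y \<in> pverts G \<Longrightarrow> \<alpha> \<in> {1..c} \<Longrightarrow>
      tensor_inner a b (u y \<alpha>) (u x \<alpha>) = 0"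
proof -
  define v where "v x \<alpha> i j = mat_app b (F x \<alpha>) (\<lambda>j. \<psi> $ (i * b + j)) j" for x \<alpha> i j
  have \<psi>: "\<psi> \<in> carrier_vec (a * b)" "\<psi> \<bullet>c \<psi> = 1"
    using W by (auto simp: winning_quantum_strategy_def)
  have E: "povm a c (E x)" and F: "povm b c (F x)" if "x \<in> pverts G" for x
    using W that by (auto simp: winning_quantum_strategy_def)
  have p: "outcome_probability \<psi> (E x \<alpha>) (F y \<beta>) = tensor_inner a b (v y \<beta>) (u x \<alpha>)"
    if "x \<in> pverts G" "y \<in> pverts G" "\<alpha> \<in> {1..c}" "\<beta> \<in> {1..c}" for x y \<alpha> \<beta>
    using outcome_probability_inner[of a "E x \<alpha>" b "F y \<beta>" \<psi>] E[OF that(1)] F[OF that(2)] that(3,4) \<psi>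
    by (simp add: povm_def u_def v_def[abs_def])
  show norm: "tensor_inner a b \<Psi> \<Psi> = 1"
    using \<psi> sum_lessThan_mult_nat[of "\<lambda>k. \<psi> $ k * cnj (\<psi> $ k)" a b]
    by (simp add: tensor_inner_def \<Psi>_def scalar_prod_def atLeast0LessThan)
  show sum_u: "(\<Sum>\<alpha>\<in>{1..c}. u x \<alpha> i j) = \<Psi> i j" if "x \<in> pverts G" "i < a" "j < b" for x i j
    using povm_sum_mat_app[OF E[OF that(1)] that(2)] by (simp add: u_def \<Psi>_def)
  have sum_v: "(\<Sum>\<alpha>\<in>{1..c}. v x \<alpha> i j) = \<Psi> i j" if "x \<in> pverts G" "i < a" "j < b" for x i j
    using povm_sum_mat_app[OF F[OF that(1)] that(3)] by (simp add: v_def \<Psi>_def)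
  have vu_0: "tensor_inner a b (v x \<beta>) (u x \<alpha>) = 0"
    if "x \<in> pverts G" "\<alpha> \<in> {1..c}" "\<beta> \<in> {1..c}" "\<alpha> \<noteq> \<beta>" for x \<alpha> \<beta>
    using W p[OF that(1,1,2,3)] that unfolding winning_quantum_strategy_def by metis
  \<comment> \<open>\<open>\<parallel>u - v\<parallel>\<^sup>2 = \<parallel>u\<parallel>\<^sup>2 + \<parallel>v\<parallel>\<^sup>2 - 2 p \<le> 0\<close>, since \<open>p = p(\<alpha>,\<alpha>|x,x)\<close> bounds both squared norms.\<close>
  have uv: "u x \<alpha> i j = v x \<alpha> i j"
    if x: "x \<in> pverts G" and \<alpha>: "\<alpha> \<in> {1..c}" and i: "i < a" and j: "j < b" for x \<alpha> i j
  proof -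
    let ?p = "tensor_inner a b (v x \<alpha>) (u x \<alpha>)"
    have "tensor_inner a b \<Psi> (u x \<alpha>) = (\<Sum>\<beta>\<in>{1..c}. tensor_inner a b (v x \<beta>) (u x \<alpha>))"
    proof -
      have "tensor_inner a b \<Psi> (u x \<alpha>)
          = (\<Sum>i<a. \<Sum>j<b. \<Sum>\<beta>\<in>{1..c}. v x \<beta> i j * cnj (u x \<alpha> i j))"
        unfolding tensor_inner_def sum_distrib_right[symmetric]
        by (intro sum.cong refl) (simp add: sum_v[OF x] del: One_nat_def)
      then show ?thesis
        unfolding tensor_inner_def by (simp only: sum.swap[of _ _ "{1..c}"])
    qed
    also have "\<dots> = (\<Sum>\<beta>\<in>{1..c}. if \<beta> = \<alpha> then ?p else 0)"
      by (rule sum.cong) (use vu_0[OF x \<alpha>] in auto)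
    finally have "tensor_inner a b \<Psi> (u x \<alpha>) = ?p" using \<alpha> by simp
    then have pu: "cnj ?p = tensor_inner a b (u x \<alpha>) \<Psi>" by (metis tensor_inner_cnj)
    have "tensor_inner a b (v x \<alpha>) \<Psi> = (\<Sum>\<beta>\<in>{1..c}. tensor_inner a b (v x \<alpha>) (u x \<beta>))"
    proof -
      have "tensor_inner a b (v x \<alpha>) \<Psi>
          = (\<Sum>i<a. \<Sum>j<b. \<Sum>\<beta>\<in>{1..c}. v x \<alpha> i j * cnj (u x \<beta> i j))"
        unfolding tensor_inner_def sum_distrib_left[symmetric] cnj_sum[symmetric]
        by (intro sum.cong refl) (simp add: sum_u[OF x] del: One_nat_def)
      then show ?thesis
        unfolding tensor_inner_def by (simp only: sum.swap[of _ _ "{1..c}"])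
    qed
    also have "\<dots> = (\<Sum>\<beta>\<in>{1..c}. if \<beta> = \<alpha> then ?p else 0)"
      by (rule sum.cong) (use vu_0[OF x _ \<alpha>] in auto)
    finally have pv: "?p = tensor_inner a b (v x \<alpha>) \<Psi>" using \<alpha> by simp
    have "(\<Sum>j<b. \<Sum>i<a. (cmod (u x \<alpha> i j))\<^sup>2) \<le> Re (tensor_inner a b (u x \<alpha>) \<Psi>)"
      unfolding tensor_inner_columns Re_sum u_def \<Psi>_def
      by (intro sum_mono povm_effect_square_le[OF E[OF x] \<alpha>])
    then have nu: "(\<Sum>i<a. \<Sum>j<b. (cmod (u x \<alpha> i j))\<^sup>2) \<le> Re ?p"
      unfolding pu[symmetric] by (subst sum.swap) simp
    have nv: "(\<Sum>i<a. \<Sum>j<b. (cmod (v x \<alpha> i j))\<^sup>2) \<le> Re ?p"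
      unfolding pv unfolding tensor_inner_rows Re_sum v_def \<Psi>_def
      by (intro sum_mono povm_effect_square_le[OF F[OF x] \<alpha>])
    have "(cmod (z - w))\<^sup>2 = (cmod z)\<^sup>2 + (cmod w)\<^sup>2 - 2 * Re (w * cnj z)" for z w
      unfolding cmod_power2 by (simp add: power2_eq_square algebra_simps)
    then have "(\<Sum>i<a. \<Sum>j<b. (cmod (u x \<alpha> i j - v x \<alpha> i j))\<^sup>2)
        = (\<Sum>i<a. \<Sum>j<b. (cmod (u x \<alpha> i j))\<^sup>2) + (\<Sum>i<a. \<Sum>j<b. (cmod (v x \<alpha> i j))\<^sup>2) - 2 * Re ?p"
      by (simp only: sum.distrib sum_subtractf tensor_inner_def Re_sum sum_distrib_left)
    then have "(\<Sum>i<a. \<Sum>j<b. (cmod (u x \<alpha> i j - v x \<alpha> i j))\<^sup>2) \<le> 0"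
      using nu nv by simp
    moreover have "(cmod (u x \<alpha> i j - v x \<alpha> i j))\<^sup>2 \<le> (\<Sum>j<b. (cmod (u x \<alpha> i j - v x \<alpha> i j))\<^sup>2)"
      by (rule member_le_sum) (use j in auto)
    moreover have "(\<Sum>j<b. (cmod (u x \<alpha> i j - v x \<alpha> i j))\<^sup>2)
        \<le> (\<Sum>i<a. \<Sum>j<b. (cmod (u x \<alpha> i j - v x \<alpha> i j))\<^sup>2)"
      by (rule member_le_sum) (use i in \<open>auto intro: sum_nonneg\<close>)
    ultimately have "(cmod (u x \<alpha> i j - v x \<alpha> i j))\<^sup>2 \<le> 0" by linarith
    then show ?thesis by simp
  qed
  have uv_inner: "tensor_inner a b (u x \<alpha>) Y = tensor_inner a b (v x \<alpha>) Y"
    if "x \<in> pverts G" "\<alpha> \<in> {1..c}" for x \<alpha> Y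
    unfolding tensor_inner_def by (intro sum.cong refl) (use uv[OF that] in auto)
  show "tensor_inner a b (u x \<alpha>) (u x \<beta>) = 0"
    if "x \<in> pverts G" "\<alpha> \<in> {1..c}" "\<beta> \<in> {1..c}" "\<alpha> \<noteq> \<beta>" for x \<alpha> \<beta>
    using vu_0[of x \<beta> \<alpha>] that by (simp add: uv_inner)
  show "tensor_inner a b (u y \<alpha>) (u x \<alpha>) = 0"
    if "(x, y) \<in> parcs G" "x \<in> pverts G" "y \<in> pverts G" "\<alpha> \<in> {1..c}" for x y \<alpha>
    using W p[OF that(2,3,4,4)] that unfolding winning_quantum_strategy_def
    by (metis uv_inner)
qed

section \<open>A Hoffman bound for quantum colourings\<close>

lemma sum_power2_le:
  fixes f :: "'a \<Rightarrow> real"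
  assumes "finite A"
  shows "(\<Sum>x\<in>A. f x)\<^sup>2 \<le> real (card A) * (\<Sum>x\<in>A. (f x)\<^sup>2)"
proof (cases "A = {}")
  case False
  let ?n = "real (card A)" and ?s = "\<Sum>x\<in>A. f x"
  have n: "0 < ?n" using False assms by (simp add: card_gt_0_iff)
  have "0 \<le> (\<Sum>x\<in>A. (?n * f x - ?s)\<^sup>2)" by (simp add: sum_nonneg)
  also have "\<dots> = ?n\<^sup>2 * (\<Sum>x\<in>A. (f x)\<^sup>2) - 2 * ?n * ?s * ?s + ?n * ?s\<^sup>2"
    by (simp add: power2_diff sum.distrib sum_subtractf power_mult_distrib mult_ac
        flip: sum_distrib_left sum_distrib_right)
  also have "\<dots> = ?n * (?n * (\<Sum>x\<in>A. (f x)\<^sup>2) - ?s\<^sup>2)"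
    by (simp add: power2_eq_square algebra_simps)
  finally show ?thesis using n by (simp add: zero_le_mult_iff)
qed simp

text \<open>
  The hypothesis on the form says that \<open>A + k I - ((d + k) / n) J\<close> is positive semidefinite, where \<open>A\<close>
  is the adjacency matrix and \<open>J\<close> the all-ones matrix; for a \<open>d\<close>-regular graph this means that no
  eigenvalue lies below \<open>-k\<close>. Apply it to each real coordinate of the vectors \<open>u\<^sub>x\<^sub>\<alpha>\<close> of a strategy,
  as functions of \<open>x\<close>, and sum over coordinates and colours. The adjacency term vanishes, the
  diagonal term is \<open>k n\<close>, and since \<open>\<Sum>\<^sub>\<alpha> \<Sum>\<^sub>x u\<^sub>x\<^sub>\<alpha> = n \<psi>\<close>, the Cauchy-Schwarz inequality over the \<open>c\<close>
  colours bounds the remaining term below by \<open>(d + k) n / c\<close>.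
\<close>

theorem quantum_hoffman_bound:
  fixes G :: "'v pair_pre_digraph" and d k :: real
  assumes G: "pair_graph G" and V: "pverts G \<noteq> {}" and c: "quantum_colorable G c"
    and form: "\<And>f :: 'v \<Rightarrow> real. (d + k) / card (pverts G) * (\<Sum>x\<in>pverts G. f x)\<^sup>2
      \<le> (\<Sum>(x, y)\<in>parcs G. f x * f y) + k * (\<Sum>x\<in>pverts G. (f x)\<^sup>2)"
    and dk: "0 \<le> d + k"
  shows "d + k \<le> k * c"
proof -
  interpret pair_graph G by fact
  obtain a b \<psi> E F where W: "winning_quantum_strategy G c a b \<psi> E F" and "0 < c"
    using c by (auto simp: quantum_colorable_def)
  define \<Psi> where "\<Psi> = (\<lambda>i j. \<psi> $ (i * b + j))"
  define u where "u = (\<lambda>x \<alpha> i j. mat_app a (E x \<alpha>) (\<lambda>i. \<psi> $ (i * b + j)) i)"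
  have unit: "tensor_inner a b \<Psi> \<Psi> = 1"
    unfolding \<Psi>_def by (rule winning_strategy_vectors(1)[OF W])
  have resolve: "(\<Sum>\<alpha>\<in>{1..c}. u x \<alpha> i j) = \<Psi> i j" if "x \<in> pverts G" "i < a" "j < b" for x i j
    unfolding \<Psi>_def u_def by (rule winning_strategy_vectors(2)[OF W that])
  have orth: "tensor_inner a b (u x \<alpha>) (u x \<beta>) = 0"
    if "x \<in> pverts G" "\<alpha> \<in> {1..c}" "\<beta> \<in> {1..c}" "\<alpha> \<noteq> \<beta>" for x \<alpha> \<beta>
    unfolding u_def by (rule winning_strategy_vectors(3)[OF W that])
  have adj: "tensor_inner a b (u y \<alpha>) (u x \<alpha>) = 0"
    if "(x, y) \<in> parcs G" "\<alpha> \<in> {1..c}" for x y \<alpha>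
    unfolding u_def
    by (rule winning_strategy_vectors(4)[OF W that(1) in_arcsD1[OF that(1)] in_arcsD2[OF that(1)] that(2)])
  define I where "I = {..<a} \<times> {..<b} \<times> {True, False}"
  define part where "part z r = (if r then Re z else Im z)" for z r
  define s where "s \<equiv> \<lambda>(i, j, r). part (\<Psi> i j) r"
  define w where "w x \<alpha> \<equiv> \<lambda>(i, j, r). part (u x \<alpha> i j) r" for x \<alpha>
  have split: "(\<Sum>\<iota>\<in>I. h \<iota>) = (\<Sum>i<a. \<Sum>j<b. h (i, j, True) + h (i, j, False))"
    for h :: "_ \<Rightarrow> real"
    by (simp add: I_def sum.cartesian_product')
  have inner: "(\<Sum>\<iota>\<in>I. w x \<alpha> \<iota> * w y \<beta> \<iota>) = Re (tensor_inner a b (u x \<alpha>) (u y \<beta>))" for x y \<alpha> \<beta>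
    by (simp add: split w_def part_def tensor_inner_def)
  have norm: "(\<Sum>\<iota>\<in>I. (s \<iota>)\<^sup>2) = 1"
    using arg_cong[OF unit, of Re]
    by (simp add: split s_def part_def tensor_inner_def power2_eq_square)
  have total: "(\<Sum>\<alpha>\<in>{1..c}. w x \<alpha> \<iota>) = s \<iota>" if x: "x \<in> pverts G" and "\<iota> \<in> I" for x \<iota>
  proof -
    obtain i j r where \<iota>: "\<iota> = (i, j, r)" "i < a" "j < b"
      using \<open>\<iota> \<in> I\<close> by (auto simp: I_def)
    show ?thesis
      using arg_cong[OF resolve[OF x \<iota>(2,3)], of Re] arg_cong[OF resolve[OF x \<iota>(2,3)], of Im]
      by (auto simp: \<iota>(1) w_def s_def part_def)
  qed
  let ?n = "real (card (pverts G))"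
  have n: "0 < ?n" using V by (simp add: card_gt_0_iff)
  \<comment> \<open>Pythagoras for the orthogonal decomposition of \<open>\<psi>\<close> at the vertex \<open>x\<close>.\<close>
  have norms: "(\<Sum>\<alpha>\<in>{1..c}. \<Sum>\<iota>\<in>I. (w x \<alpha> \<iota>)\<^sup>2) = 1" if x: "x \<in> pverts G" for x
  proof -
    have "1 = (\<Sum>\<iota>\<in>I. (\<Sum>\<alpha>\<in>{1..c}. w x \<alpha> \<iota>)\<^sup>2)"
      using norm total[OF x] by simp
    also have "\<dots> = (\<Sum>\<alpha>\<in>{1..c}. \<Sum>\<beta>\<in>{1..c}. \<Sum>\<iota>\<in>I. w x \<alpha> \<iota> * w x \<beta> \<iota>)"
      unfolding power2_eq_square sum_product
      by (subst sum.swap) (simp only: sum.swap[of _ I])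
    also have "\<dots> = (\<Sum>\<alpha>\<in>{1..c}. \<Sum>\<beta>\<in>{1..c}. if \<alpha> = \<beta> then \<Sum>\<iota>\<in>I. (w x \<alpha> \<iota>)\<^sup>2 else 0)"
      by (intro sum.cong refl) (use inner orth[OF x] in \<open>auto simp: power2_eq_square simp del: One_nat_def\<close>)
    finally show ?thesis by simp
  qed
  have "(d + k) / ?n * (?n\<^sup>2 / c)
      = (\<Sum>\<iota>\<in>I. (d + k) / ?n * ((?n * s \<iota>)\<^sup>2 / c))"
    using norm by (simp add: power_mult_distrib flip: sum_distrib_left sum_divide_distrib)
  also have "\<dots> \<le> (\<Sum>\<iota>\<in>I. (d + k) / ?n * (\<Sum>\<alpha>\<in>{1..c}. (\<Sum>x\<in>pverts G. w x \<alpha> \<iota>)\<^sup>2))"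
  proof (intro sum_mono mult_left_mono)
    fix \<iota> assume \<iota>: "\<iota> \<in> I"
    have "?n * s \<iota> = (\<Sum>x\<in>pverts G. \<Sum>\<alpha>\<in>{1..c}. w x \<alpha> \<iota>)"
      using total[OF _ \<iota>] by simp
    also have "\<dots> = (\<Sum>\<alpha>\<in>{1..c}. \<Sum>x\<in>pverts G. w x \<alpha> \<iota>)" by (rule sum.swap)
    finally show "(?n * s \<iota>)\<^sup>2 / c \<le> (\<Sum>\<alpha>\<in>{1..c}. (\<Sum>x\<in>pverts G. w x \<alpha> \<iota>)\<^sup>2)"
      using sum_power2_le[of "{1..c}" "\<lambda>\<alpha>. \<Sum>x\<in>pverts G. w x \<alpha> \<iota>"] \<open>0 < c\<close>
      by (simp add: divide_le_eq mult.commute)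
  qed (use dk n in auto)
  also have "\<dots> = (\<Sum>\<iota>\<in>I. \<Sum>\<alpha>\<in>{1..c}. (d + k) / ?n * (\<Sum>x\<in>pverts G. w x \<alpha> \<iota>)\<^sup>2)"
    by (simp only: sum_distrib_left)
  also have "\<dots> \<le> (\<Sum>\<iota>\<in>I. \<Sum>\<alpha>\<in>{1..c}.
      (\<Sum>(x, y)\<in>parcs G. w x \<alpha> \<iota> * w y \<alpha> \<iota>) + k * (\<Sum>x\<in>pverts G. (w x \<alpha> \<iota>)\<^sup>2))"
    by (intro sum_mono form)
  also have "\<dots> = (\<Sum>\<alpha>\<in>{1..c}. \<Sum>(x, y)\<in>parcs G. \<Sum>\<iota>\<in>I. w x \<alpha> \<iota> * w y \<alpha> \<iota>)
      + k * (\<Sum>x\<in>pverts G. \<Sum>\<alpha>\<in>{1..c}. \<Sum>\<iota>\<in>I. (w x \<alpha> \<iota>)\<^sup>2)"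
    unfolding sum.distrib sum_distrib_left[symmetric] split_def
    by (simp only: sum.swap[of _ _ I] sum.swap[of _ "pverts G"])
  also have "(\<Sum>\<alpha>\<in>{1..c}. \<Sum>(x, y)\<in>parcs G. \<Sum>\<iota>\<in>I. w x \<alpha> \<iota> * w y \<alpha> \<iota>) = 0"
  proof (intro sum.neutral ballI)
    fix \<alpha> e assume \<alpha>: "\<alpha> \<in> {1..c}" and "e \<in> parcs G"
    moreover obtain x y where e: "e = (x, y)" by (cases e)
    ultimately have "(y, x) \<in> parcs G" using arcs_symmetric by simp
    from adj[OF this \<alpha>] show "(case e of (x, y) \<Rightarrow> \<Sum>\<iota>\<in>I. w x \<alpha> \<iota> * w y \<alpha> \<iota>) = 0"
      by (simp add: e inner)
  qed
  also have "0 + k * (\<Sum>x\<in>pverts G. \<Sum>\<alpha>\<in>{1..c}. \<Sum>\<iota>\<in>I. (w x \<alpha> \<iota>)\<^sup>2) = k * ?n"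
    using norms by simp
  also have "(d + k) / ?n * (?n\<^sup>2 / c) = ?n * (d + k) / c"
    using n by (simp add: power2_eq_square)
  finally have "?n * (d + k) \<le> ?n * (k * c)"
    using \<open>0 < c\<close> by (simp add: divide_le_eq mult_ac)
  then show ?thesis using n by simp
qed

text \<open>
  Functions \<open>\<phi>\<^sub>j\<close> with \<open>\<Sum>\<^sub>j \<phi>\<^sub>j(x) \<phi>\<^sub>j(y) = n [x = y]\<close> form a tight frame, and if the adjacency
  matrix is diagonal in this frame with coefficients \<open>\<mu>\<^sub>j\<close>, then both sides are weighted sums of the
  squared Fourier coefficients of \<open>f\<close>. On the right the weights \<open>\<mu>\<^sub>j + k\<close> are nonnegative, and the
  left side keeps only the term of the constant function.
\<close>

lemma adjacency_form_ge:
  fixes \<phi> :: "'j \<Rightarrow> 'v \<Rightarrow> real" and \<mu> :: "'j \<Rightarrow> real" and f :: "'v \<Rightarrow> real"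
  assumes V: "finite V" and R: "R \<subseteq> V \<times> V" and J: "finite J" "j0 \<in> J" and n: "0 < n"
    and const: "\<And>x. x \<in> V \<Longrightarrow> \<phi> j0 x = 1"
    and basis: "\<And>x y. x \<in> V \<Longrightarrow> y \<in> V \<Longrightarrow> (\<Sum>j\<in>J. \<phi> j x * \<phi> j y) = (if x = y then n else 0)"
    and spectrum: "\<And>x y. x \<in> V \<Longrightarrow> y \<in> V \<Longrightarrow>
      (\<Sum>j\<in>J. \<mu> j * (\<phi> j x * \<phi> j y)) = (if (x, y) \<in> R then n else 0)"
    and lower: "\<And>j. j \<in> J \<Longrightarrow> 0 \<le> \<mu> j + k"
  shows "(\<mu> j0 + k) / n * (\<Sum>x\<in>V. f x)\<^sup>2 \<le> (\<Sum>(x, y)\<in>R. f x * f y) + k * (\<Sum>x\<in>V. (f x)\<^sup>2)"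
proof -
  define F where "F j = (\<Sum>x\<in>V. \<phi> j x * f x)" for j
  have square: "(\<Sum>j\<in>J. c j * (F j)\<^sup>2)
      = (\<Sum>x\<in>V. \<Sum>y\<in>V. (\<Sum>j\<in>J. c j * (\<phi> j x * \<phi> j y)) * (f x * f y))" for c
  proof -
    have "(\<Sum>j\<in>J. c j * (F j)\<^sup>2)
        = (\<Sum>j\<in>J. \<Sum>x\<in>V. \<Sum>y\<in>V. c j * (\<phi> j x * \<phi> j y) * (f x * f y))"
      unfolding F_def power2_eq_square sum_product by (simp add: sum_distrib_left mult_ac)
    then show ?thesis unfolding sum_distrib_right by (simp only: sum.swap[of _ _ J])
  qed
  have norm: "(\<Sum>j\<in>J. (F j)\<^sup>2) = n * (\<Sum>x\<in>V. (f x)\<^sup>2)"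
  proof -
    have "(\<Sum>j\<in>J. (F j)\<^sup>2) = (\<Sum>x\<in>V. \<Sum>y\<in>V. (if x = y then n else 0) * (f x * f y))"
      using square[of "\<lambda>_. 1"] by (simp add: basis)
    also have "\<dots> = (\<Sum>x\<in>V. \<Sum>y\<in>V. if x = y then n * (f x)\<^sup>2 else 0)"
      by (intro sum.cong refl) (simp add: power2_eq_square)
    also have "\<dots> = (\<Sum>x\<in>V. n * (f x)\<^sup>2)" using V by simp
    finally show ?thesis by (simp add: sum_distrib_left)
  qed
  have adjacency: "(\<Sum>j\<in>J. \<mu> j * (F j)\<^sup>2) = n * (\<Sum>(x, y)\<in>R. f x * f y)"
  proof -
    have "(\<Sum>j\<in>J. \<mu> j * (F j)\<^sup>2)
        = (\<Sum>x\<in>V. \<Sum>y\<in>V. (if (x, y) \<in> R then n else 0) * (f x * f y))"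
      unfolding square by (simp add: spectrum)
    also have "\<dots> = (\<Sum>e\<in>V \<times> V. if e \<in> R then n * (f (fst e) * f (snd e)) else 0)"
      unfolding sum.cartesian_product by (intro sum.cong refl) auto
    also have "\<dots> = (\<Sum>e\<in>R. n * (f (fst e) * f (snd e)))"
      using V R by (simp add: sum.inter_restrict[symmetric] Int_absorb1)
    finally show ?thesis by (simp add: sum_distrib_left split_def)
  qed
  have "(\<mu> j0 + k) * (\<Sum>x\<in>V. f x)\<^sup>2 = (\<mu> j0 + k) * (F j0)\<^sup>2"
    by (simp add: F_def const)
  also have "\<dots> \<le> (\<Sum>j\<in>J. (\<mu> j + k) * (F j)\<^sup>2)"
    by (rule member_le_sum) (use J lower in auto)
  also have "\<dots> = n * ((\<Sum>(x, y)\<in>R. f x * f y) + k * (\<Sum>x\<in>V. (f x)\<^sup>2))"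
    by (simp add: distrib_right sum.distrib adjacency norm algebra_simps flip: sum_distrib_left)
  finally show ?thesis using n by (simp add: field_simps)
qed

section \<open>The spectrum of the Hadamard graph\<close>

definition balanced_vectors :: "nat \<Rightarrow> int vec set" where
  "balanced_vectors N = {z \<in> sign_vectors N. (\<Sum>i<N. z $ i) = 0}"

definition character :: "nat set \<Rightarrow> int vec \<Rightarrow> int" where
  "character S x = (\<Prod>i\<in>S. x $ i)"

text \<open>
  For even \<open>N\<close> this is the value at \<open>|S|\<close> of the Krawtchouk polynomial of degree \<open>N/2\<close>; the neighbours of \<open>x\<close> in the Hadamard graph are the coordinatewise products of
  \<open>x\<close> with balanced vectors.
\<close>

definition hadamard_eigenvalue :: "nat \<Rightarrow> nat set \<Rightarrow> int" where
  "hadamard_eigenvalue N S = (\<Sum>z\<in>balanced_vectors N. character S z)"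

lemma finite_balanced_vectors: "finite (balanced_vectors N)"
  by (simp add: balanced_vectors_def finite_sign_vectors)

lemma sign_vector_nth: "x \<in> sign_vectors N \<Longrightarrow> i < N \<Longrightarrow> x $ i = 1 \<or> x $ i = -1"
  by (auto simp: sign_vectors_def)

lemma sign_vector_nth_square: "x \<in> sign_vectors N \<Longrightarrow> i < N \<Longrightarrow> x $ i * x $ i = 1"
  by (auto dest: sign_vector_nth)

lemma sign_vector_nth_mult_self:
  "x \<in> sign_vectors N \<Longrightarrow> i < N \<Longrightarrow> x $ i * (x $ i * c) = c"
  using sign_vector_nth_square[of x N i] by (simp flip: mult.assoc)

lemma dim_sign_vector: "x \<in> sign_vectors N \<Longrightarrow> dim_vec x = N"
  by (auto simp: sign_vectors_def)

lemma card_sign_vectors: "card (sign_vectors N) = 2 ^ N"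
proof -
  have "bij_betw (\<lambda>z. {i\<in>{..<N}. z $ i = -1}) (sign_vectors N) (Pow {..<N})"
  proof (rule bij_betw_byWitness[where f' = "\<lambda>S. vec N (\<lambda>i. if i \<in> S then -1 else 1)"])
    show "\<forall>z\<in>sign_vectors N. vec N (\<lambda>i. if i \<in> {i\<in>{..<N}. z $ i = -1} then -1 else 1) = z"
    proof
      fix z assume z: "z \<in> sign_vectors N"
      show "vec N (\<lambda>i. if i \<in> {i\<in>{..<N}. z $ i = -1} then -1 else 1) = z"
        by (rule eq_vecI) (use sign_vector_nth[OF z] dim_sign_vector[OF z] in auto)
    qed
  qed (auto simp: sign_vectors_def split: if_splits)
  then show ?thesis by (simp add: bij_betw_same_card card_Pow)
qed

text \<open>
  Some permutation of the coordinates carries \<open>S\<close> to \<open>T\<close>, and it permutes the balanced vectors.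
\<close>

lemma hadamard_eigenvalue_card_eq:
  assumes S: "S \<subseteq> {..<N}" and T: "T \<subseteq> {..<N}" and card: "card S = card T"
  shows "hadamard_eigenvalue N S = hadamard_eigenvalue N T"
proof -
  have fin: "finite S" "finite T" using S T finite_subset by auto
  obtain f where f: "bij_betw f S T"
    using finite_same_card_bij[OF fin card] by blast
  have "card ({..<N} - S) = card ({..<N} - T)"
    using S T fin card by (simp add: card_Diff_subset)
  then obtain g where g: "bij_betw g ({..<N} - S) ({..<N} - T)"
    using finite_same_card_bij[of "{..<N} - S" "{..<N} - T"] by auto
  define p where "p i = (if i \<in> S then f i else g i)" for i
  have pS: "bij_betw p S T" using f by (rule bij_betw_cong[THEN iffD1, rotated]) (simp add: p_def)
  have "bij_betw p ({..<N} - S) ({..<N} - T)"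
    using g by (rule bij_betw_cong[THEN iffD1, rotated]) (simp add: p_def)
  with pS have "bij_betw p (S \<union> ({..<N} - S)) (T \<union> ({..<N} - T))"
    by (rule bij_betw_combine) auto
  then have p: "bij_betw p {..<N} {..<N}" using S T by (simp add: Un_absorb1)
  define q where "q = inv_into {..<N} p"
  have q: "bij_betw q {..<N} {..<N}" unfolding q_def by (rule bij_betw_inv_into[OF p])
  have pq: "p (q i) = i" "q (p i) = i" "p i < N" "q i < N" if "i < N" for i
    using p q that bij_betw_inv_into_left[OF p, of i] bij_betw_inv_into_right[OF p, of i]
    by (auto simp: q_def bij_betw_def)
  let ?P = "\<lambda>z :: int vec. vec N (\<lambda>i. z $ p i)" and ?Q = "\<lambda>z :: int vec. vec N (\<lambda>i. z $ q i)"
  have sum: "(\<Sum>i<N. z $ r i) = (\<Sum>i<N. z $ i)" if "bij_betw r {..<N} {..<N}"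
    for z :: "int vec" and r
    by (rule sum.reindex_bij_betw[OF that])
  show ?thesis unfolding hadamard_eigenvalue_def
  proof (rule sum.reindex_bij_witness[of _ ?P ?Q])
    fix z assume z: "z \<in> balanced_vectors N"
    then have d: "dim_vec z = N" by (simp add: balanced_vectors_def dim_sign_vector)
    show "?P (?Q z) = z" "?Q (?P z) = z" by (rule eq_vecI; simp add: d pq)+
    show "?Q z \<in> balanced_vectors N" "?P z \<in> balanced_vectors N"
      using z sum[OF p, of z] sum[OF q, of z] by (auto simp: balanced_vectors_def sign_vectors_def pq)
    have "character T (?Q z) = (\<Prod>i\<in>S. ?Q z $ p i)"
      unfolding character_def by (rule prod.reindex_bij_betw[OF pS, symmetric])
    also have "\<dots> = character S z"
      unfolding character_def by (rule prod.cong) (use S pq in \<open>auto simp: subset_iff\<close>)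
    finally show "character T (?Q z) = character S z" .
  qed
qed

lemma character_times_nth:
  assumes z: "z \<in> sign_vectors N" and S: "S \<subseteq> {..<N}" and i: "i < N"
  shows "character S z * z $ i = character (if i \<in> S then S - {i} else insert i S) z"
proof -
  have fin: "finite S" using S finite_subset by auto
  show ?thesis
  proof (cases "i \<in> S")
    case True
    then have "character S z = z $ i * character (S - {i}) z"
      using fin by (simp add: character_def prod.remove)
    then show ?thesis
      using True sign_vector_nth_mult_self[OF z i] by (simp add: mult_ac)
  next
    case False
    then show ?thesis using fin by (simp add: character_def mult.commute)
  qed
qed

text \<open>
  Sum \<open>\<chi>\<^sub>S(z) \<Sum>\<^sub>i z\<^sub>i = 0\<close> over the balanced vectors: multiplying the character of a set \<open>S\<close> of size
  \<open>s\<close> by \<open>z\<^sub>i\<close> removes \<open>i\<close> from \<open>S\<close> in \<open>s\<close> cases and adds it in the other \<open>N - s\<close> cases.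
\<close>

lemma hadamard_eigenvalue_recursion:
  assumes "0 < s" "s < N"
  shows "int s * hadamard_eigenvalue N {..<s - 1}
    + int (N - s) * hadamard_eigenvalue N {..<s + 1} = 0"
proof -
  have S: "{..<s} \<subseteq> {..<N}" using assms by auto
  have "0 = (\<Sum>z\<in>balanced_vectors N. character {..<s} z * (\<Sum>i<N. z $ i))"
    by (simp add: balanced_vectors_def)
  also have "\<dots> = (\<Sum>z\<in>balanced_vectors N. \<Sum>i<N.
      character (if i \<in> {..<s} then {..<s} - {i} else insert i {..<s}) z)"
    unfolding sum_distrib_left
    by (intro sum.cong refl character_times_nth[OF _ S]) (auto simp: balanced_vectors_def)
  also have "\<dots> = (\<Sum>i<N. hadamard_eigenvalue N
      (if i \<in> {..<s} then {..<s} - {i} else insert i {..<s}))"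
    unfolding hadamard_eigenvalue_def by (rule sum.swap)
  also have "\<dots> = (\<Sum>i<N. if i < s then hadamard_eigenvalue N {..<s - 1}
      else hadamard_eigenvalue N {..<s + 1})"
  proof (rule sum.cong[OF refl])
    fix i assume i: "i \<in> {..<N}"
    show "hadamard_eigenvalue N (if i \<in> {..<s} then {..<s} - {i} else insert i {..<s})
        = (if i < s then hadamard_eigenvalue N {..<s - 1} else hadamard_eigenvalue N {..<s + 1})"
    proof (cases "i < s")
      case True
      have "hadamard_eigenvalue N ({..<s} - {i}) = hadamard_eigenvalue N {..<s - 1}"
        by (rule hadamard_eigenvalue_card_eq) (use True assms in auto)
      then show ?thesis using True by simp
    next
      case False
      have "hadamard_eigenvalue N (insert i {..<s}) = hadamard_eigenvalue N {..<s + 1}"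
        by (rule hadamard_eigenvalue_card_eq) (use False i assms in auto)
      then show ?thesis using False by simp
    qed
  qed
  also have "\<dots> = int s * hadamard_eigenvalue N {..<s - 1}
    + int (N - s) * hadamard_eigenvalue N {..<s + 1}"
  proof -
    have "{..<N} \<inter> {i. i < s} = {..<s}" "{..<N} \<inter> - {i. i < s} = {s..<N}"
      using assms by auto
    then show ?thesis by (simp add: sum.If_cases)
  qed
  finally show ?thesis by simp
qed

text \<open>
  Exactly \<open>N/2\<close> entries are \<open>-1\<close>, an even number. This is where divisibility by \<open>4\<close> enters: for
  \<open>N \<equiv> 2\<close> modulo \<open>4\<close> the full set has eigenvalue \<open>-d\<close>.
\<close>

lemma prod_balanced_vector:
  assumes N: "4 dvd N" and z: "z \<in> balanced_vectors N"
  shows "(\<Prod>i<N. z $ i) = 1"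
proof -
  let ?m = "{i\<in>{..<N}. z $ i = -1}" and ?p = "{i\<in>{..<N}. z $ i = 1}"
  have s: "z $ i = 1 \<or> z $ i = -1" if "i < N" for i
    using z that sign_vector_nth[of z N i] by (simp add: balanced_vectors_def)
  have U: "{..<N} = ?p \<union> ?m" "?p \<inter> ?m = {}" using s by auto
  have "0 = sum (($) z) ({..<N})" using z by (simp add: balanced_vectors_def)
  also have "\<dots> = sum (($) z) ?p + sum (($) z) ?m"
    by (subst U(1), rule sum.union_disjoint) (use U(2) in auto)
  also have "\<dots> = int (card ?p) - int (card ?m)" by simp
  finally have "card ?p = card ?m" by simp
  moreover have "N = card ?p + card ?m"
    using card_Un_disjoint[of ?p ?m] U(2) unfolding U(1)[symmetric] by simp
  ultimately have "even (card ?m)" using N by presburger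
  have "prod (($) z) {..<N} = prod (($) z) ?p * prod (($) z) ?m"
    by (subst U(1), rule prod.union_disjoint) (use U(2) in auto)
  also have "\<dots> = (-1) ^ card ?m" by simp
  also have "\<dots> = 1" using \<open>even (card ?m)\<close> by simp
  finally show ?thesis .
qed

lemma character_square:
  assumes "x \<in> sign_vectors N" "S \<subseteq> {..<N}"
  shows "character S x * character S x = 1"
  unfolding character_def prod.distrib[symmetric]
  by (rule prod.neutral) (use assms in \<open>auto intro!: sign_vector_nth_square\<close>)

lemma hadamard_eigenvalue_complement:
  assumes N: "4 dvd N" and S: "S \<subseteq> {..<N}"
  shows "hadamard_eigenvalue N ({..<N} - S) = hadamard_eigenvalue N S"
  unfolding hadamard_eigenvalue_def
proof (rule sum.cong[OF refl])
  fix z assume z: "z \<in> balanced_vectors N"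
  have "character S z * character S z = 1"
    using z S by (intro character_square) (auto simp: balanced_vectors_def)
  moreover have "character ({..<N} - S) z * character S z = 1"
    using prod.subset_diff[OF S, of "($) z"] prod_balanced_vector[OF N z]
    by (simp add: character_def)
  ultimately show "character ({..<N} - S) z = character S z"
    by (metis mult.assoc mult.commute mult.right_neutral)
qed

lemma hadamard_eigenvalue_empty: "hadamard_eigenvalue N {} = int (card (balanced_vectors N))"
  by (simp add: hadamard_eigenvalue_def character_def)

text \<open>
  Write \<open>g(s)\<close> for the eigenvalue of a set of size \<open>s\<close>. Then \<open>g(1) = 0\<close>, and the recursion gives
  \<open>g(2) = - g(0) / (N - 1)\<close>. From there on \<open>|g(s)| = (s - 1) / (N - s + 1) |g(s - 2)|\<close>, and the factor
  is at most \<open>1\<close> as long as \<open>2 s \<le> N + 2\<close>.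
\<close>

lemma hadamard_eigenvalue_abs_le_half:
  assumes N: "2 \<le> N" and "1 \<le> s" "2 * s \<le> N + 2"
  shows "(int N - 1) * \<bar>hadamard_eigenvalue N {..<s}\<bar> \<le> hadamard_eigenvalue N {}"
  using assms(2,3)
proof (induction s rule: less_induct)
  case (less s)
  let ?g = "\<lambda>s. hadamard_eigenvalue N {..<s}"
  have d: "0 \<le> hadamard_eigenvalue N {}" by (simp add: hadamard_eigenvalue_empty)
  consider "s = 1" | "s = 2" | "3 \<le> s" using less.prems by linarith
  then show ?case
  proof cases
    case 1
    have "int N * ?g 1 = (\<Sum>i<N. hadamard_eigenvalue N {i})"
    proof -
      have "hadamard_eigenvalue N {i} = ?g 1" if "i < N" for i
        by (rule hadamard_eigenvalue_card_eq) (use that in auto)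
      then show ?thesis by simp
    qed
    also have "\<dots> = (\<Sum>z\<in>balanced_vectors N. \<Sum>i<N. z $ i)"
      unfolding hadamard_eigenvalue_def character_def by (subst sum.swap) simp
    also have "\<dots> = 0" by (simp add: balanced_vectors_def)
    finally show ?thesis using 1 N d by simp
  next
    case 2
    have "hadamard_eigenvalue N {} + int (N - 1) * ?g 2 = 0"
      using hadamard_eigenvalue_recursion[of 1 N] N by (simp add: numeral_2_eq_2)
    then have "(int N - 1) * ?g 2 = - hadamard_eigenvalue N {}" using N by (simp add: of_nat_diff)
    then have "\<bar>(int N - 1) * ?g 2\<bar> = hadamard_eigenvalue N {}" using d by simp
    then show ?thesis using 2 N by (simp add: abs_mult)
  next
    case 3
    define t where "t = s - 2"
    have t: "s = t + 2" "1 \<le> t" using 3 by (auto simp: t_def)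
    have "int (t + 1) * ?g t + int (N - (t + 1)) * ?g s = 0"
      using hadamard_eigenvalue_recursion[of "t + 1" N] less.prems t by simp
    then have "\<bar>int (N - (t + 1)) * ?g s\<bar> = \<bar>int (t + 1) * ?g t\<bar>" by linarith
    then have eq: "int (N - (t + 1)) * \<bar>?g s\<bar> = int (t + 1) * \<bar>?g t\<bar>"
      by (simp only: abs_mult abs_of_nat)
    have le: "int (t + 1) \<le> int (N - (t + 1))" using less.prems t by linarith
    have "int (t + 1) * \<bar>?g s\<bar> \<le> int (N - (t + 1)) * \<bar>?g s\<bar>"
      using le by (rule mult_right_mono) simp
    then have "int (t + 1) * \<bar>?g s\<bar> \<le> int (t + 1) * \<bar>?g t\<bar>" by (simp only: eq)
    then have "\<bar>?g s\<bar> \<le> \<bar>?g t\<bar>" by simp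
    then have "(int N - 1) * \<bar>?g s\<bar> \<le> (int N - 1) * \<bar>?g t\<bar>"
      by (rule mult_left_mono) (use N in simp)
    also have "\<dots> \<le> hadamard_eigenvalue N {}"
      by (rule less.IH) (use t less.prems in auto)
    finally show ?thesis .
  qed
qed

text \<open>
  Complementation reduces to sets of at most half size; there either the set is empty and the
  eigenvalue is nonnegative, or the bound on absolute values applies.
\<close>

lemma hadamard_eigenvalue_ge:
  assumes N: "4 dvd N" "0 < N" and S: "S \<subseteq> {..<N}"
  shows "- hadamard_eigenvalue N {} \<le> (int N - 1) * hadamard_eigenvalue N S"
proof -
  have "2 \<le> N" using N by (auto elim: dvdE)
  define s where "s = card S"
  have s: "s \<le> N" using S unfolding s_def by (metis card_lessThan card_mono finite_lessThan)
  have S': "hadamard_eigenvalue N S = hadamard_eigenvalue N {..<s}"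
    by (rule hadamard_eigenvalue_card_eq) (use S s in \<open>auto simp: s_def\<close>)
  have bound: ?thesis if "hadamard_eigenvalue N S = hadamard_eigenvalue N {..<t}" "2 * t \<le> N" for t
  proof (cases "t = 0")
    case True
    have "0 \<le> hadamard_eigenvalue N {}" by (simp add: hadamard_eigenvalue_empty)
    moreover from this have "0 \<le> (int N - 1) * hadamard_eigenvalue N {}"
      using \<open>2 \<le> N\<close> by simp
    ultimately show ?thesis using True that by simp
  next
    case False
    have "\<bar>(int N - 1) * hadamard_eigenvalue N {..<t}\<bar> \<le> hadamard_eigenvalue N {}"
      using hadamard_eigenvalue_abs_le_half[of N t] \<open>2 \<le> N\<close> False that by (simp add: abs_mult)
    then show ?thesis using that(1) by simp
  qed
  show ?thesis
  proof (cases "2 * s \<le> N")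
    case True
    then show ?thesis using bound S' by blast
  next
    case False
    have "hadamard_eigenvalue N {..<s} = hadamard_eigenvalue N ({..<N} - {..<s})"
      using hadamard_eigenvalue_complement[OF N(1), of "{..<s}"] s by simp
    also have "\<dots> = hadamard_eigenvalue N {..<N - s}"
      by (rule hadamard_eigenvalue_card_eq) (use s in \<open>auto simp: card_Diff_subset\<close>)
    finally show ?thesis using bound S' False by simp
  qed
qed

lemma hadamard_eigenvalue_le:
  assumes "S \<subseteq> {..<N}"
  shows "\<bar>hadamard_eigenvalue N S\<bar> \<le> hadamard_eigenvalue N {}"
proof -
  have "\<bar>character S z\<bar> = 1" if "z \<in> balanced_vectors N" for z
    using character_square[of z N S] that assms
    by (auto simp: balanced_vectors_def zmult_eq_1_iff)
  then show ?thesis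
    unfolding hadamard_eigenvalue_empty
    using sum_abs[of "character S" "balanced_vectors N"] by (simp add: hadamard_eigenvalue_def)
qed

lemma hadamard_eigenvalue_empty_pos:
  assumes "even N" shows "0 < hadamard_eigenvalue N {}"
proof -
  obtain h where h: "N = 2 * h" using assms by (elim evenE)
  define z :: "int vec" where "z = vec N (\<lambda>i. if i < h then 1 else -1)"
  have "(\<Sum>i<N. z $ i) = (\<Sum>i<N. if i < h then 1 else -1)" by (simp add: z_def)
  also have "\<dots> = int (card ({..<N} \<inter> {i. i < h})) - int (card ({..<N} \<inter> - {i. i < h}))"
    by (simp add: sum.If_cases)
  also have "{..<N} \<inter> {i. i < h} = {..<h}" using h by auto
  also have "{..<N} \<inter> - {i. i < h} = {h..<N}" by auto
  finally have "z \<in> balanced_vectors N"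
    using h by (simp add: balanced_vectors_def sign_vectors_def z_def)
  then show ?thesis
    using finite_balanced_vectors by (auto simp: hadamard_eigenvalue_empty card_gt_0_iff)
qed

text \<open>
  The sum over \<open>S\<close> factors as \<open>\<Prod>\<^sub>i (1 + x\<^sub>i y\<^sub>i)\<close>.
\<close>

lemma character_orthogonality:
  assumes x: "x \<in> sign_vectors N" and y: "y \<in> sign_vectors N"
  shows "(\<Sum>S\<in>Pow {..<N}. character S x * character S y) = (if x = y then 2 ^ N else 0)"
proof -
  have "(\<Sum>S\<in>Pow {..<N}. character S x * character S y)
      = (\<Prod>i<N. x $ i * y $ i + 1)"
    by (simp add: prod_add character_def prod.distrib)
  also have "\<dots> = (if x = y then 2 ^ N else 0)"
  proof (cases "x = y")
    case True
    then show ?thesis using sign_vector_nth_square[OF x] by simp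
  next
    case False
    then obtain i where i: "i < N" "x $ i \<noteq> y $ i"
      using dim_sign_vector[OF x] dim_sign_vector[OF y] by (metis eq_vecI)
    then have "x $ i * y $ i + 1 = 0"
      using sign_vector_nth[OF x i(1)] sign_vector_nth[OF y i(1)] by auto
    then show ?thesis using False i(1) by (auto simp: prod_zero_iff)
  qed
  finally show ?thesis .
qed

lemma character_eigenvector:
  assumes x: "x \<in> sign_vectors N" and S: "S \<subseteq> {..<N}"
  shows "(\<Sum>y\<in>{y\<in>sign_vectors N. x \<bullet> y = 0}. character S y)
    = hadamard_eigenvalue N S * character S x"
proof -
  let ?m = "\<lambda>z. vec N (\<lambda>i. x $ i * z $ i)"
  have m: "?m (?m z) = z" if "z \<in> sign_vectors N" for z
    using sign_vector_nth_mult_self[OF x] dim_sign_vector[OF that] by (intro eq_vecI) auto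
  have s: "?m z \<in> sign_vectors N" if "z \<in> sign_vectors N" for z
    using sign_vector_nth[OF x] sign_vector_nth[OF that] by (fastforce simp: sign_vectors_def)
  have dot: "x \<bullet> y = (\<Sum>i<N. x $ i * y $ i)" if "y \<in> sign_vectors N" for y
    using dim_sign_vector[OF that] by (simp add: scalar_prod_def atLeast0LessThan)
  have sq: "(\<Sum>i<N. x $ i * ?m z $ i) = (\<Sum>i<N. z $ i)" for z
    by (rule sum.cong) (auto simp: sign_vector_nth_mult_self[OF x])
  have "(\<Sum>y\<in>{y\<in>sign_vectors N. x \<bullet> y = 0}. character S y)
      = (\<Sum>z\<in>balanced_vectors N. character S z * character S x)"
  proof (rule sum.reindex_bij_witness[of _ ?m ?m])
    fix y assume y: "y \<in> {y\<in>sign_vectors N. x \<bullet> y = 0}"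
    show "?m (?m y) = y" using m y by simp
    show "?m y \<in> balanced_vectors N" using y s dot[of y] by (simp add: balanced_vectors_def)
    show "character S (?m y) * character S x = character S y"
      unfolding character_def prod.distrib[symmetric]
      by (rule prod.cong) (use S sign_vector_nth_mult_self[OF x] in \<open>auto simp: mult_ac subset_iff\<close>)
  next
    fix z assume z: "z \<in> balanced_vectors N"
    then have z': "z \<in> sign_vectors N" by (simp add: balanced_vectors_def)
    show "?m (?m z) = z" using m z' .
    show "?m z \<in> {y\<in>sign_vectors N. x \<bullet> y = 0}"
      using s[OF z'] dot[OF s[OF z']] sq[of z] z by (simp add: balanced_vectors_def)
  qed
  then show ?thesis by (simp add: hadamard_eigenvalue_def sum_distrib_right)
qed

text \<open>
  The eigenvector equation and orthogonality combine to the spectral decomposition of the adjacency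
  matrix, scaled by \<open>2\<^sup>N\<close>.
\<close>

lemma hadamard_adjacency_expansion:
  assumes x: "x \<in> sign_vectors N" and y: "y \<in> sign_vectors N"
  shows "(\<Sum>S\<in>Pow {..<N}. hadamard_eigenvalue N S * (character S x * character S y))
    = (if x \<bullet> y = 0 then 2 ^ N else 0)"
proof -
  let ?B = "{y\<in>sign_vectors N. x \<bullet> y = 0}"
  have "(\<Sum>S\<in>Pow {..<N}. hadamard_eigenvalue N S * (character S x * character S y))
      = (\<Sum>S\<in>Pow {..<N}. \<Sum>z\<in>?B. character S z * character S y)"
    using character_eigenvector[OF x]
    by (intro sum.cong refl) (simp add: mult.assoc flip: sum_distrib_right)
  also have "\<dots> = (\<Sum>z\<in>?B. if z = y then 2 ^ N else 0)"
    by (subst sum.swap) (intro sum.cong refl, simp add: character_orthogonality y)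
  also have "\<dots> = (if x \<bullet> y = 0 then 2 ^ N else 0)"
    using y finite_sign_vectors[of N] by simp
  finally show ?thesis .
qed

section \<open>Colourings from orthonormal bases\<close>

lemma quantum_colorable_homomorphism:
  assumes "quantum_colorable H c"
    and "\<And>x. x \<in> pverts G \<Longrightarrow> h x \<in> pverts H"
    and "\<And>x y. (x, y) \<in> parcs G \<Longrightarrow> (h x, h y) \<in> parcs H"
  shows "quantum_colorable G c"
proof -
  obtain a b \<psi> E F where "0 < c" and W: "winning_quantum_strategy H c a b \<psi> E F"
    using assms(1) by (auto simp: quantum_colorable_def)
  have "winning_quantum_strategy G c a b \<psi> (E \<circ> h) (F \<circ> h)"
    using W assms(2,3) unfolding winning_quantum_strategy_def comp_def by blast
  with \<open>0 < c\<close> show ?thesis unfolding quantum_colorable_def by blast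
qed

lemma positive_semidefinite_rank_one:
  "positive_semidefinite n (mat n n (\<lambda>(i, j). f i * cnj (f j)))"
  unfolding positive_semidefinite_def
proof (intro conjI ballI)
  let ?A = "mat n n (\<lambda>(i, j). f i * cnj (f j))"
  show "?A \<in> carrier_mat n n" by simp
  fix v :: "complex vec" assume v: "v \<in> carrier_vec n"
  let ?z = "inner_prod n f (\<lambda>i. v $ i)"
  have "(?A *\<^sub>v v) \<bullet>c v = (\<Sum>i<n. (\<Sum>j<n. f i * cnj (f j) * v $ j) * cnj (v $ i))"
    using v by (auto simp: scalar_prod_def atLeast0LessThan intro!: sum.cong)
  also have "\<dots> = (\<Sum>i<n. \<Sum>j<n. (f i * cnj (v $ i)) * cnj (f j * cnj (v $ j)))"
    unfolding sum_distrib_right by (simp add: mult_ac)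
  also have "\<dots> = ?z * cnj ?z"
    unfolding inner_prod_def cnj_sum sum_product ..
  also have "\<dots> = of_real ((cmod ?z)\<^sup>2)" by (simp only: complex_norm_square)
  finally show "0 \<le> (?A *\<^sub>v v) \<bullet>c v" by (simp add: less_eq_complex_def)
qed

definition maximally_entangled :: "nat \<Rightarrow> complex vec" where
  "maximally_entangled n = vec (n * n) (\<lambda>k. if k div n = k mod n then 1 / of_real (sqrt n) else 0)"

lemma maximally_entangled_carrier: "maximally_entangled n \<in> carrier_vec (n * n)"
  by (simp add: maximally_entangled_def)

lemma maximally_entangled_nth:
  "i < n \<Longrightarrow> j < n \<Longrightarrow> maximally_entangled n $ (i * n + j) = (if i = j then 1 / of_real (sqrt n) else 0)"
  by (simp add: maximally_entangled_def pair_index_less)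

lemma sum_diagonal:
  fixes g :: "nat \<Rightarrow> nat \<Rightarrow> complex"
  shows "(\<Sum>i<n. \<Sum>j<n. if i = j then g i j else 0) = (\<Sum>i<n. g i i)"
  by simp

text \<open>
  For a maximally entangled state the probability is \<open>tr (A B\<^sup>T) / n\<close>.
\<close>

lemma outcome_probability_maximally_entangled:
  assumes A: "A \<in> carrier_mat n n" and B: "B \<in> carrier_mat n n"
  shows "outcome_probability (maximally_entangled n) A B
    = (\<Sum>i<n. \<Sum>j<n. A $$ (i, j) * B $$ (i, j)) / of_nat n"
proof -
  let ?s = "1 / complex_of_real (sqrt n)"
  have s: "?s * ?s = 1 / of_nat n"
    by (simp flip: of_real_mult)
  have "outcome_probability (maximally_entangled n) A B
      = (\<Sum>i<n. \<Sum>j<n. (\<Sum>i'<n. \<Sum>j'<n. A $$ (i, i') * B $$ (j, j')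
          * (if i' = j' then ?s else 0)) * cnj (if i = j then ?s else 0))"
    by (subst outcome_probability_sum[OF A B])
      (auto simp: maximally_entangled_nth maximally_entangled_carrier intro!: sum.cong)
  also have "\<dots> = (\<Sum>i<n. \<Sum>j<n. if i = j
      then (\<Sum>i'<n. \<Sum>j'<n. if i' = j' then A $$ (i, i') * B $$ (j, j') * ?s else 0) * ?s else 0)"
    by (intro sum.cong refl) (auto intro!: sum.cong simp del: sum.delta sum.delta')
  also have "\<dots> = (\<Sum>i<n. (\<Sum>i'<n. A $$ (i, i') * B $$ (i, i') * ?s) * ?s)"
    by (simp only: sum_diagonal)
  also have "\<dots> = (\<Sum>i<n. \<Sum>j<n. A $$ (i, j) * B $$ (i, j)) * (?s * ?s)"
    by (simp only: sum_distrib_right mult.assoc)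
  finally show ?thesis unfolding s by simp
qed

text \<open>
  The players measure a maximally entangled state in the basis of their vertex, the second player in
  the complex conjugate of it. By the trace formula the probability of the outcomes \<open>\<alpha>, \<beta>\<close> is
  \<open>|\<langle>\<phi>\<^sub>x\<^sub>\<alpha>, \<phi>\<^sub>y\<^sub>\<beta>\<rangle>|\<^sup>2 / c\<close>.
\<close>

lemma quantum_colorable_bases:
  fixes G :: "'v pair_pre_digraph" and \<phi> :: "'v \<Rightarrow> nat \<Rightarrow> nat \<Rightarrow> complex"
  assumes "0 < c"
    and complete: "\<And>x i j. x \<in> pverts G \<Longrightarrow> i < c \<Longrightarrow> j < c \<Longrightarrow>
      (\<Sum>\<alpha>\<in>{1..c}. \<phi> x \<alpha> i * cnj (\<phi> x \<alpha> j)) = (if i = j then 1 else 0)"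
    and orth: "\<And>x \<alpha> \<beta>. x \<in> pverts G \<Longrightarrow> \<alpha> \<in> {1..c} \<Longrightarrow> \<beta> \<in> {1..c} \<Longrightarrow> \<alpha> \<noteq> \<beta> \<Longrightarrow>
      inner_prod c (\<phi> x \<alpha>) (\<phi> x \<beta>) = 0"
    and adj: "\<And>x y \<alpha>. (x, y) \<in> parcs G \<Longrightarrow> \<alpha> \<in> {1..c} \<Longrightarrow> inner_prod c (\<phi> x \<alpha>) (\<phi> y \<alpha>) = 0"
  shows "quantum_colorable G c"
proof -
  define E where "E x \<alpha> = mat c c (\<lambda>(i, j). \<phi> x \<alpha> i * cnj (\<phi> x \<alpha> j))" for x \<alpha>
  define F where "F x \<alpha> = mat c c (\<lambda>(i, j). cnj (\<phi> x \<alpha> i) * cnj (cnj (\<phi> x \<alpha> j)))" for x \<alpha>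
  have p: "outcome_probability (maximally_entangled c) (E x \<alpha>) (F y \<beta>) = 0"
    if "inner_prod c (\<phi> x \<alpha>) (\<phi> y \<beta>) = 0" for x y \<alpha> \<beta>
  proof -
    have "(\<Sum>i<c. \<Sum>j<c. E x \<alpha> $$ (i, j) * F y \<beta> $$ (i, j))
        = inner_prod c (\<phi> x \<alpha>) (\<phi> y \<beta>) * cnj (inner_prod c (\<phi> x \<alpha>) (\<phi> y \<beta>))"
      by (simp add: E_def F_def inner_prod_def sum_product mult_ac)
    moreover have "E x \<alpha> \<in> carrier_mat c c" "F y \<beta> \<in> carrier_mat c c" by (auto simp: E_def F_def)
    ultimately show ?thesis using that by (simp add: outcome_probability_maximally_entangled)
  qed
  have unit: "maximally_entangled c \<bullet>c maximally_entangled c = 1"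
  proof -
    have "maximally_entangled c \<bullet>c maximally_entangled c
        = (\<Sum>k<c * c. maximally_entangled c $ k * cnj (maximally_entangled c $ k))"
      by (simp add: scalar_prod_def atLeast0LessThan maximally_entangled_def)
    also have "\<dots> = (\<Sum>i<c. \<Sum>j<c. if i = j then 1 / of_nat c else 0)"
      unfolding sum_lessThan_mult_nat
      by (intro sum.cong refl) (simp add: maximally_entangled_nth flip: of_real_mult)
    also have "\<dots> = 1" using \<open>0 < c\<close> by simp
    finally show ?thesis .
  qed
  have povms: "povm c c (E x) \<and> povm c c (F x)" if x: "x \<in> pverts G" for x
  proof -
    have "positive_semidefinite c (E x \<alpha>)" "positive_semidefinite c (F x \<alpha>)" for \<alpha>
      unfolding E_def F_def by (rule positive_semidefinite_rank_one)+
    moreover have "(\<Sum>\<alpha>\<in>{1..c}. E x \<alpha> $$ (i, j)) = (if i = j then 1 else 0)"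
      if "i < c" "j < c" for i j
      using complete[OF x that] that by (simp add: E_def)
    moreover have "(\<Sum>\<alpha>\<in>{1..c}. F x \<alpha> $$ (i, j)) = (if i = j then 1 else 0)"
      if "i < c" "j < c" for i j
      using complete[OF x that(2,1)] that by (simp add: F_def mult.commute)
    ultimately show ?thesis by (auto simp: povm_def simp del: One_nat_def intro!: eq_matI)
  qed
  have "winning_quantum_strategy G c c c (maximally_entangled c) E F"
    unfolding winning_quantum_strategy_def
    using \<open>0 < c\<close> povms unit p orth adj by (auto simp: maximally_entangled_def)
  then show ?thesis using \<open>0 < c\<close> unfolding quantum_colorable_def by blast
qed

lemma sum_roots_of_unity:
  fixes k :: int
  assumes n: "0 < n" and k: "\<not> int n dvd k"
  defines "z \<equiv> cis (2 * pi * k / n)"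
  shows "(\<Sum>i<n. z ^ i) = 0" and "(\<Sum>i\<in>{1..n}. z ^ i) = 0"
proof -
  have "z \<noteq> 1"
  proof
    assume "z = 1"
    then have "cos (2 * pi * k / n) = 1" by (simp add: z_def complex_eq_iff)
    then obtain m :: int where "2 * pi * k / n = of_int m * 2 * pi"
      by (auto simp: cos_one_2pi_int)
    then have "real_of_int k = of_int (m * int n)" using n by (simp add: field_simps)
    then have "k = m * int n" by (simp only: of_int_eq_iff)
    then show False using k by simp
  qed
  moreover have "z ^ n = 1"
  proof -
    have "z ^ n = cis (2 * pi * k)" using n by (simp add: z_def DeMoivre)
    then show ?thesis by (simp add: complex_eq_iff cos_int_2pin sin_int_2pin)
  qed
  ultimately show *: "(\<Sum>i<n. z ^ i) = 0" by (simp add: geometric_sum)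
  have "(\<Sum>i\<in>{1..n}. z ^ i) = z * (\<Sum>i<n. z ^ i)"
    unfolding sum_distrib_left
    by (rule sum.reindex_bij_witness[of _ Suc "\<lambda>i. i - 1"]) (auto simp flip: power_Suc)
  then show "(\<Sum>i\<in>{1..n}. z ^ i) = 0" by (simp add: *)
qed

text \<open>
  The vectors are those of the discrete Fourier basis multiplied coordinatewise by \<open>x\<close>. Such a
  change of signs is unitary, so the result is again a basis, while vectors with equal index at different vertices have
  equal phases, which leaves \<open>x \<bullet> y / N\<close>.
\<close>

lemma hadamard_quantum_colorable:
  assumes N: "0 < N"
  shows "quantum_colorable (hadamard_graph N) N"
proof -
  define \<omega> where "\<omega> k = cis (2 * pi * of_int k / N)" for k :: int
  define \<phi> :: "int vec \<Rightarrow> nat \<Rightarrow> nat \<Rightarrow> complex" where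
    "\<phi> x \<alpha> i = of_int (x $ i) * cis (2 * pi * \<alpha> * i / N) / of_real (sqrt N)" for x \<alpha> i
  have \<phi>: "\<phi> x \<alpha> i * cnj (\<phi> y \<beta> j)
      = of_int (x $ i * y $ j) * cis (2 * pi * (real \<alpha> * i - real \<beta> * j) / N) / of_nat N"
    for x y \<alpha> \<beta> i j
  proof -
    have "cis (2 * pi * \<alpha> * i / N) * cnj (cis (2 * pi * \<beta> * j / N))
        = cis (2 * pi * (real \<alpha> * i - real \<beta> * j) / N)"
      by (simp add: cis_cnj cis_mult algebra_simps diff_divide_distrib)
    moreover have "complex_of_real (sqrt N) * complex_of_real (sqrt N) = of_nat N"
      by (simp flip: of_real_mult)
    ultimately show ?thesis
      unfolding \<phi>_def by (simp add: times_divide_times_eq)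
  qed
  have not_dvd: "\<not> int N dvd int i - int j" if "i \<noteq> j" "\<bar>int i - int j\<bar> < int N" for i j
    using that dvd_imp_le_int[of "int i - int j" "int N"] by auto
  show ?thesis
  proof (rule quantum_colorable_bases[OF N])
    fix x i j assume x: "x \<in> pverts (hadamard_graph N)" and ij: "i < N" "j < N"
    have x: "x \<in> sign_vectors N" using x by (simp add: hadamard_graph_def)
    have "(\<Sum>\<alpha>\<in>{1..N}. \<phi> x \<alpha> i * cnj (\<phi> x \<alpha> j))
        = (\<Sum>\<alpha>\<in>{1..N}. of_int (x $ i * x $ j) / of_nat N * \<omega> (int i - int j) ^ \<alpha>)"
      by (intro sum.cong refl) (simp add: \<phi> \<omega>_def DeMoivre algebra_simps)
    also have "\<dots> = of_int (x $ i * x $ j) / of_nat N * (\<Sum>\<alpha>\<in>{1..N}. \<omega> (int i - int j) ^ \<alpha>)"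
      by (rule sum_distrib_left[symmetric])
    also have "\<dots> = (if i = j then 1 else 0)"
    proof (cases "i = j")
      case True
      then show ?thesis using N sign_vector_nth_square[OF x ij(1)] by (simp add: \<omega>_def)
    next
      case False
      then show ?thesis
        using sum_roots_of_unity(2)[OF N not_dvd[OF False]] ij by (simp add: \<omega>_def)
    qed
    finally show "(\<Sum>\<alpha>\<in>{1..N}. \<phi> x \<alpha> i * cnj (\<phi> x \<alpha> j)) = (if i = j then 1 else 0)" .
  next
    fix x \<alpha> \<beta>
    assume x: "x \<in> pverts (hadamard_graph N)" and \<alpha>\<beta>: "\<alpha> \<in> {1..N}" "\<beta> \<in> {1..N}" "\<alpha> \<noteq> \<beta>"
    have x: "x \<in> sign_vectors N" using x by (simp add: hadamard_graph_def)
    have "inner_prod N (\<phi> x \<alpha>) (\<phi> x \<beta>) = (\<Sum>i<N. 1 / of_nat N * \<omega> (int \<alpha> - int \<beta>) ^ i)"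
      unfolding inner_prod_def
      by (intro sum.cong refl) (simp add: \<phi> \<omega>_def DeMoivre algebra_simps sign_vector_nth_square[OF x]
          flip: of_int_mult)
    also have "\<dots> = 1 / of_nat N * (\<Sum>i<N. \<omega> (int \<alpha> - int \<beta>) ^ i)"
      by (rule sum_distrib_left[symmetric])
    also have "\<dots> = 0"
      using sum_roots_of_unity(1)[OF N not_dvd[OF \<alpha>\<beta>(3)]] \<alpha>\<beta> by (auto simp: \<omega>_def)
    finally show "inner_prod N (\<phi> x \<alpha>) (\<phi> x \<beta>) = 0" .
  next
    fix x y \<alpha> assume "(x, y) \<in> parcs (hadamard_graph N)"
    then have xy: "x \<bullet> y = 0" "dim_vec y = N"
      by (auto simp: hadamard_graph_def dim_sign_vector)
    have "inner_prod N (\<phi> x \<alpha>) (\<phi> y \<alpha>) = of_int (x \<bullet> y) / of_nat N"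
      by (simp add: inner_prod_def \<phi> scalar_prod_def xy(2) atLeast0LessThan sum_divide_distrib)
    then show "inner_prod N (\<phi> x \<alpha>) (\<phi> y \<alpha>) = 0" by (simp add: xy)
  qed
qed

section \<open>The product of two Hadamard graphs\<close>

text \<open>
  The product is negative only if exactly one factor is, and then that factor is bounded by its lower bound
  and the other by its absolute value. The bound is worse when the negative factor belongs to the
  smaller graph, whence the constant \<open>m\<close>.
\<close>

lemma product_eigenvalue_ge:
  fixes p q :: int and n m dn dm :: int
  assumes p: "\<bar>p\<bar> \<le> dn" "- dn \<le> n * p" and q: "\<bar>q\<bar> \<le> dm" "- dm \<le> m * q"
    and mn: "0 \<le> m" "m \<le> n"
  shows "- (dn * dm) \<le> m * (p * q)"
proof (cases "0 \<le> p")
  case True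
  have "p * dm \<le> dn * dm" using p(1) q(1) by (intro mult_right_mono) auto
  moreover have "p * (- dm) \<le> p * (m * q)" using True q(2) by (rule mult_left_mono[rotated])
  ultimately show ?thesis by (simp add: mult_ac)
next
  case p_neg: False
  show ?thesis
  proof (cases "0 \<le> q")
    case True
    have "n * p \<le> m * p" using p_neg mn by (intro mult_right_mono_neg) auto
    then have "(- dn) * q \<le> (m * p) * q" using p(2) True by (intro mult_right_mono) auto
    moreover have "dn * q \<le> dn * dm" using p(1) q(1) by (intro mult_left_mono) auto
    ultimately show ?thesis by (simp add: mult_ac)
  next
    case False
    have "0 \<le> p * q" using p_neg False by (simp add: mult_nonpos_nonpos)
    then have "0 \<le> m * (p * q)" using mn by simp
    moreover have "0 \<le> dn * dm" using p(1) q(1) by simp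
    ultimately show ?thesis by simp
  qed
qed

text \<open>
  The Hoffman bound with \<open>k = d / (M - 1)\<close>, using products of characters as eigenvectors of the
  categorical product.
\<close>

lemma quantum_colorable_product_ge:
  assumes N: "4 dvd N" and M: "4 dvd M" "0 < M" "M < N"
    and c: "quantum_colorable (categorical_product (hadamard_graph N) (hadamard_graph M)) c"
  shows "M \<le> c"
proof -
  let ?G = "categorical_product (hadamard_graph N) (hadamard_graph M)"
  let ?V = "sign_vectors N \<times> sign_vectors M"
  let ?J = "Pow {..<N} \<times> Pow {..<M}"
  have M1: "1 < M" using M by (auto elim: dvdE)
  define \<phi> where "\<phi> = (\<lambda>(S, T) (x, y). real_of_int (character S x * character T y))"
  define \<mu> where "\<mu> = (\<lambda>(S, T). real_of_int (hadamard_eigenvalue N S * hadamard_eigenvalue M T))"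
  define d where "d = \<mu> ({}, {})"
  define k where "k = d / (real M - 1)"
  have V: "pverts ?G = ?V" by (simp add: categorical_product_def hadamard_graph_def)
  have graph: "pair_graph ?G"
    using M by (intro pair_graph_categorical_product pair_graph_hadamard_graph) auto
  have arcs: "(x, y) \<in> parcs ?G \<longleftrightarrow> fst x \<bullet> fst y = 0 \<and> snd x \<bullet> snd y = 0"
    if "x \<in> ?V" "y \<in> ?V" for x y
    using that by (cases x, cases y) (auto simp: categorical_product_def hadamard_graph_def)
  have product_sum: "(\<Sum>(S, T)\<in>?J. real_of_int (g S * h T)) = real_of_int (sum g (Pow {..<N}) * sum h (Pow {..<M}))"
    for g h :: "nat set \<Rightarrow> int"
    by (simp add: sum_product sum.cartesian_product split_def)
  have d: "0 < d"
    using hadamard_eigenvalue_empty_pos[of N] hadamard_eigenvalue_empty_pos[of M]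
      dvd_trans[of 2 4 N] dvd_trans[of 2 4 M] N M
    by (simp add: d_def \<mu>_def)
  have k: "0 < k" using d M1 by (simp add: k_def)
  have lower: "0 \<le> \<mu> j + k" if "j \<in> ?J" for j
  proof -
    obtain S T where j: "j = (S, T)" "S \<subseteq> {..<N}" "T \<subseteq> {..<M}" using \<open>j \<in> ?J\<close> by auto
    have "- (hadamard_eigenvalue N {} * hadamard_eigenvalue M {})
        \<le> (int M - 1) * (hadamard_eigenvalue N S * hadamard_eigenvalue M T)"
      by (rule product_eigenvalue_ge[where n = "int N - 1"])
        (use N M j in \<open>auto intro: hadamard_eigenvalue_le hadamard_eigenvalue_ge\<close>)
    then have "real_of_int (- (hadamard_eigenvalue N {} * hadamard_eigenvalue M {}))
        \<le> real_of_int ((int M - 1) * (hadamard_eigenvalue N S * hadamard_eigenvalue M T))"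
      by (simp only: of_int_le_iff)
    then have "- d \<le> (real M - 1) * \<mu> j" by (simp add: d_def \<mu>_def j)
    then show ?thesis using M1 by (simp add: k_def field_simps)
  qed
  have "(d + k) / card (pverts ?G) * (\<Sum>x\<in>pverts ?G. f x)\<^sup>2
      \<le> (\<Sum>(x, y)\<in>parcs ?G. f x * f y) + k * (\<Sum>x\<in>pverts ?G. (f x)\<^sup>2)" for f
    unfolding V d_def
  proof (rule adjacency_form_ge[where J = ?J and \<phi> = \<phi>])
    show "parcs ?G \<subseteq> ?V \<times> ?V"
      by (auto simp: categorical_product_def hadamard_graph_def)
    have card: "real (card ?V) = 2 ^ N * 2 ^ M"
      by (simp add: card_cartesian_product card_sign_vectors)
    fix x y assume x: "x \<in> ?V" and y: "y \<in> ?V"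
    have xy: "fst x \<in> sign_vectors N" "snd x \<in> sign_vectors M"
      "fst y \<in> sign_vectors N" "snd y \<in> sign_vectors M" using x y by auto
    have "(\<Sum>j\<in>?J. \<phi> j x * \<phi> j y) = (\<Sum>(S, T)\<in>?J. real_of_int
        ((character S (fst x) * character S (fst y)) * (character T (snd x) * character T (snd y))))"
      by (rule sum.cong) (auto simp: \<phi>_def split_def)
    then show "(\<Sum>j\<in>?J. \<phi> j x * \<phi> j y) = (if x = y then real (card ?V) else 0)"
      unfolding product_sum character_orthogonality[OF xy(1,3)] character_orthogonality[OF xy(2,4)]
      by (simp add: card prod_eq_iff)
    have "(\<Sum>j\<in>?J. \<mu> j * (\<phi> j x * \<phi> j y)) = (\<Sum>(S, T)\<in>?J. real_of_int
        ((hadamard_eigenvalue N S * (character S (fst x) * character S (fst y)))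
          * (hadamard_eigenvalue M T * (character T (snd x) * character T (snd y)))))"
      by (rule sum.cong) (auto simp: \<phi>_def \<mu>_def split_def)
    then show "(\<Sum>j\<in>?J. \<mu> j * (\<phi> j x * \<phi> j y)) = (if (x, y) \<in> parcs ?G then real (card ?V) else 0)"
      unfolding product_sum hadamard_adjacency_expansion[OF xy(1,3)]
        hadamard_adjacency_expansion[OF xy(2,4)] arcs[OF x y]
      by (simp add: card)
  qed (use lower in \<open>auto simp: finite_sign_vectors card_sign_vectors \<phi>_def character_def\<close>)
  moreover have "pverts ?G \<noteq> {}"
    using card_sign_vectors[of N] card_sign_vectors[of M] unfolding V by force
  ultimately have "d + k \<le> k * c"
    using d k by (intro quantum_hoffman_bound[OF graph _ c]) auto
  moreover have "d = k * (real M - 1)" using M1 by (simp add: k_def)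
  ultimately have "k * real M \<le> k * real c" by (simp add: algebra_simps)
  then show ?thesis using k by simp
qed

theorem theorem0p2:
  fixes N M :: nat
  assumes "0 < N" and "0 < M" and "4 dvd N" and "4 dvd M" and "N > M"
  shows "quantum_chromatic_number (categorical_product (hadamard_graph N) (hadamard_graph M)) = M"
  unfolding quantum_chromatic_number_def
proof (rule Least_equality)
  show "quantum_colorable (categorical_product (hadamard_graph N) (hadamard_graph M)) M"
    by (rule quantum_colorable_homomorphism[OF hadamard_quantum_colorable[OF \<open>0 < M\<close>], where h = snd])
      (auto simp: categorical_product_def)
  show "M \<le> c"
    if "quantum_colorable (categorical_product (hadamard_graph N) (hadamard_graph M)) c" for c
    by (rule quantum_colorable_product_ge[OF assms(3,4,2,5) that])
qed

end
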